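(* Let $G$ be a maximal pseudo-outerplanar graph. Then $G$ is obtained in the following way. Start from a maximal pseudo-outerplanar graph $H$ given with a pseudo-outerplanar diagram, and pick a boundary edge $xy$ of $H$. Take a new copy of $K_3$ or of $K_4$ and identify one of its edges with $xy$.
   Context: All graphs are finite, simple and undirected. A block is a maximal 2-connected subgraph; bridges are blocks too. A graph is pseudo-outerplanar if each of its blocks can be drawn in the plane so that its vertices lie on a fixed circle, its edges lie inside the disk bounded by that circle, and each edge crosses at most one other edge. A pseudo-outerplanar diagram is such a drawing of the blocks with the minimum number of crossings. A pseudo-outerplanar graph is maximal if adding any new edge yields a graph that is not pseudo-outerplanar. In the diagram, if the vertices of a block $B$ are $v_1,\dots,v_{|B|}$ in clockwise order, the edges $v_iv_{i+1}$ (indices mod $|B|$) are its boundary edges.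
   Formalization: The graph G is assumed to have at least three vertices; the claim as stated fails for maximal pseudo-outerplanar graphs with at most two vertices (e.g. K_2), since identifying an edge of K_3 or K_4 with xy always yields at least three vertices. *)

theory Defs
  imports "HOL-Analysis.Analysis"
begin

type_synonym 'a graph = "'a set \<times> 'a set set"

abbreviation verts :: "'a graph \<Rightarrow> 'a set" where "verts \<equiv> fst"
abbreviation edges :: "'a graph \<Rightarrow> 'a set set" where "edges \<equiv> snd"

definition simple_graph :: "'a graph \<Rightarrow> bool" where
  "simple_graph G \<longleftrightarrow> finite (verts G) \<and> (\<forall>e\<in>edges G. e \<subseteq> verts G \<and> card e = 2)"

definition subgraph :: "'a graph \<Rightarrow> 'a graph \<Rightarrow> bool" where
  "subgraph B G \<longleftrightarrow> simple_graph B \<and> verts B \<subseteq> verts G \<and> edges B \<subseteq> edges G"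

definition graph_union :: "'a graph \<Rightarrow> 'a graph \<Rightarrow> 'a graph" where
  "graph_union G H = (verts G \<union> verts H, edges G \<union> edges H)"

definition add_edge :: "'a graph \<Rightarrow> 'a set \<Rightarrow> 'a graph" where
  "add_edge G e = (verts G, insert e (edges G))"

definition delete_edge :: "'a graph \<Rightarrow> 'a set \<Rightarrow> 'a graph" where
  "delete_edge G e = (verts G, edges G - {e})"

definition delete_vertex :: "'a graph \<Rightarrow> 'a \<Rightarrow> 'a graph" where
  "delete_vertex G v = (verts G - {v}, {e \<in> edges G. v \<notin> e})"

definition reachable :: "'a graph \<Rightarrow> 'a \<Rightarrow> 'a \<Rightarrow> bool" where
  "reachable G u v \<longleftrightarrow> (u, v) \<in> {(a, b). {a, b} \<in> edges G}\<^sup>*"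

definition connected_graph :: "'a graph \<Rightarrow> bool" where
  "connected_graph G \<longleftrightarrow>
     verts G \<noteq> {} \<and> (\<forall>u\<in>verts G. \<forall>v\<in>verts G. reachable G u v)"

definition two_connected :: "'a graph \<Rightarrow> bool" where
  "two_connected G \<longleftrightarrow>
     card (verts G) \<ge> 3 \<and> connected_graph G \<and>
     (\<forall>v\<in>verts G. connected_graph (delete_vertex G v))"

definition bridge :: "'a graph \<Rightarrow> 'a set \<Rightarrow> bool" where
  "bridge G e \<longleftrightarrow>
     e \<in> edges G \<and> (\<exists>u v. e = {u, v} \<and> \<not> reachable (delete_edge G e) u v)"

definition block :: "'a graph \<Rightarrow> 'a graph \<Rightarrow> bool" where
  "block G B \<longleftrightarrow>
     (subgraph B G \<and> two_connected B \<and>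
        (\<forall>C. subgraph C G \<and> two_connected C \<and> subgraph B C \<longrightarrow> C = B)) \<or>
     (\<exists>e. bridge G e \<and> B = (e, {e}))"

definition complete_graph :: "nat \<Rightarrow> 'a graph \<Rightarrow> bool" where
  "complete_graph n K \<longleftrightarrow>
     finite (verts K) \<and> card (verts K) = n \<and> edges K = {e. e \<subseteq> verts K \<and> card e = 2}"

type_synonym 'a drawing = "('a \<Rightarrow> complex) \<times> ('a set \<Rightarrow> real \<Rightarrow> complex)"

abbreviation point_of :: "'a drawing \<Rightarrow> 'a \<Rightarrow> complex" where "point_of \<equiv> fst"
abbreviation curve_of :: "'a drawing \<Rightarrow> 'a set \<Rightarrow> real \<Rightarrow> complex" where "curve_of \<equiv> snd"

text \<open>The fixed circle is the unit circle. Edges are arbitrary simple curves in the closed disk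
  (in particular they need not be straight, and may run along the circle). As usual for drawings,
  an edge meets the vertices only in its endpoints, and two edges have finitely many common
  points; without the latter, \<^term>\<open>card\<close> would not count crossings.\<close>

definition disk_drawing :: "'a graph \<Rightarrow> 'a drawing \<Rightarrow> bool" where
  "disk_drawing B d \<longleftrightarrow>
     inj_on (point_of d) (verts B) \<and>
     point_of d ` verts B \<subseteq> sphere 0 1 \<and>
     (\<forall>e\<in>edges B.
        arc (curve_of d e) \<and>
        path_image (curve_of d e) \<subseteq> cball 0 1 \<and>
        {pathstart (curve_of d e), pathfinish (curve_of d e)} = point_of d ` e \<and>
        path_image (curve_of d e) \<inter> point_of d ` verts B = point_of d ` e) \<and>
     (\<forall>e\<in>edges B. \<forall>f\<in>edges B. e \<noteq> f \<longrightarrow>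
        finite (path_image (curve_of d e) \<inter> path_image (curve_of d f)))"

text \<open>Any common point of two edges that is not a common endpoint is a crossing.\<close>

definition crossing_points :: "'a graph \<Rightarrow> 'a drawing \<Rightarrow> 'a set \<Rightarrow> 'a set \<Rightarrow> complex set" where
  "crossing_points B d e f =
     path_image (curve_of d e) \<inter> path_image (curve_of d f) - point_of d ` verts B"

definition pseudo_outerplanar_drawing :: "'a graph \<Rightarrow> 'a drawing \<Rightarrow> bool" where
  "pseudo_outerplanar_drawing B d \<longleftrightarrow>
     disk_drawing B d \<and>
     (\<forall>e\<in>edges B. card {f \<in> edges B. f \<noteq> e \<and> crossing_points B d e f \<noteq> {}} \<le> 1)"

text \<open>In a pseudo-outerplanar drawing no three edges meet in a crossing, so that counting
  crossings is counting points.\<close>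

definition crossing_number_of :: "'a graph \<Rightarrow> 'a drawing \<Rightarrow> nat" where
  "crossing_number_of B d =
     card (\<Union>e\<in>edges B. \<Union>f\<in>edges B - {e}. crossing_points B d e f)"

definition pseudo_outerplanar :: "'a graph \<Rightarrow> bool" where
  "pseudo_outerplanar G \<longleftrightarrow>
     simple_graph G \<and> (\<forall>B. block G B \<longrightarrow> (\<exists>d. pseudo_outerplanar_drawing B d))"

definition maximal_pseudo_outerplanar :: "'a graph \<Rightarrow> bool" where
  "maximal_pseudo_outerplanar G \<longleftrightarrow>
     pseudo_outerplanar G \<and>
     (\<forall>u\<in>verts G. \<forall>v\<in>verts G. u \<noteq> v \<and> {u, v} \<notin> edges G \<longrightarrow>
        \<not> pseudo_outerplanar (add_edge G {u, v}))"

text \<open>Blocks are drawn separately, so a drawing of the blocks is a function assigning a drawing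
  to each block; its values at other arguments are irrelevant.\<close>

definition block_drawing :: "'a graph \<Rightarrow> ('a graph \<Rightarrow> 'a drawing) \<Rightarrow> bool" where
  "block_drawing G D \<longleftrightarrow> (\<forall>B. block G B \<longrightarrow> pseudo_outerplanar_drawing B (D B))"

definition total_crossings :: "'a graph \<Rightarrow> ('a graph \<Rightarrow> 'a drawing) \<Rightarrow> nat" where
  "total_crossings G D = (\<Sum>B | block G B. crossing_number_of B (D B))"

definition pseudo_outerplanar_diagram :: "'a graph \<Rightarrow> ('a graph \<Rightarrow> 'a drawing) \<Rightarrow> bool" where
  "pseudo_outerplanar_diagram G D \<longleftrightarrow>
     block_drawing G D \<and>
     (\<forall>D'. block_drawing G D' \<longrightarrow> total_crossings G D \<le> total_crossings G D')"

text \<open>\<open>vs\<close> lists the vertices of \<open>B\<close> in the order in which they are met in one clockwise turn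
  around the circle, starting from \<open>vs ! 0\<close>.\<close>

definition clockwise_order :: "'a graph \<Rightarrow> 'a drawing \<Rightarrow> 'a list \<Rightarrow> bool" where
  "clockwise_order B d vs \<longleftrightarrow>
     distinct vs \<and> set vs = verts B \<and>
     (\<exists>\<theta> :: nat \<Rightarrow> real.
        (\<forall>i<length vs. point_of d (vs ! i) = cis (\<theta> i)) \<and>
        (\<forall>i j. i < j \<and> j < length vs \<longrightarrow> \<theta> j < \<theta> i) \<and>
        (\<forall>i<length vs. \<theta> 0 - \<theta> i < 2 * pi))"

definition boundary_edge :: "'a graph \<Rightarrow> ('a graph \<Rightarrow> 'a drawing) \<Rightarrow> 'a set \<Rightarrow> bool" where
  "boundary_edge G D e \<longleftrightarrow>
     (\<exists>B vs i. block G B \<and> clockwise_order B (D B) vs \<and> i < length vs \<and>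
        e = {vs ! i, vs ! ((i + 1) mod length vs)} \<and> e \<in> edges B)"

text \<open>Identifying an edge of \<open>K\<close> with the edge \<open>xy\<close> of \<open>H\<close>: once the identified vertices are
  given the same names, the result is the union of two graphs that share exactly \<open>x\<close>, \<open>y\<close>
  and the edge between them.\<close>

definition glued_along_edge :: "'a graph \<Rightarrow> 'a graph \<Rightarrow> 'a graph \<Rightarrow> 'a \<Rightarrow> 'a \<Rightarrow> bool" where
  "glued_along_edge G H K x y \<longleftrightarrow>
     x \<noteq> y \<and> {x, y} \<in> edges H \<and> {x, y} \<in> edges K \<and>
     verts H \<inter> verts K = {x, y} \<and> G = graph_union H K"

end

(*
A drawing of a graph in the disk induces a cyclic order of its vertices, and edges whose ends interleave
in that order must cross; conversely straight chords cross only if their ends interleave. Gluing the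
orders of the blocks at cut vertices, a graph is pseudo-outerplanar iff its vertices have an order in
which each edge crosses (interleaves) at most one other edge.

Let G be maximal, with such an order. Consecutive vertices are adjacent, and a crossing pair ac, bd spans a
K_4. An innermost uncrossed chord xy cuts off a triangle or a K_4; this is K, and H is the rest. That H
is again maximal rests on two facts. First, by maximality of G two triangles never share an edge, which
amounts to: every non-edge uv of G crosses an edge of a crossing pair ac, bd, and this passes to H.
Second, in any admissible order of any supergraph of H the K_4 on a, b, c, d has a crossing pair
of edges, which no other edge crosses, so each component of the rest is attached to at most two of
a, b, c, d; the boundary cycle of H and uv together violate this.

Every K_4 contributes its own crossing to every drawing, so the straight drawing of H in the inherited
order, in which xy is a boundary edge, has the minimum number of crossings.
*)
theory Submission
  imports Defs
begin

section \<open>Interleaving\<close>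

text \<open>A graph may have several admissible orders, so maximality of \<open>H\<close> must be
  shown against every order of \<open>H\<close> with \<open>uv\<close> added, not only the inherited
  one. The invariants are therefore order-free: in any linear order some pairing of the vertices of
  a K_4 interleaves, and links through vertices outside the K_4 do not mention the order. Edges of a
  drawing are arbitrary curves, so that interleaving ends force a crossing is a topological fact. It
  comes from the Fashoda theorem for paths in a box, after the circle has been opened at a point
  that both curves avoid. The converse is needed only for straight chords, where it is a sign
  computation. Linear orders stand for cyclic ones: interleaving is invariant under rotation, which
  allows a separating vertex to be moved to an end and a given vertex to the front. Consecutive
  vertices being adjacent, a maximal graph on three or more vertices has a Hamiltonian cycle and is
  a single block; a single edge is a bridge. Hence one drawing, assigned to all blocks alike, can
  serve as a diagram.\<close>

definition interleave :: "'b::linorder \<Rightarrow> 'b \<Rightarrow> 'b \<Rightarrow> 'b \<Rightarrow> bool" where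
  "interleave a c b d \<longleftrightarrow>
     min a c < min b d \<and> min b d < max a c \<and> max a c < max b d \<or>
     min b d < min a c \<and> min a c < max b d \<and> max b d < max a c"

lemma interleave_sym: "interleave a c b d \<longleftrightarrow> interleave b d a c"
  by (auto simp: interleave_def)

lemma interleave_swap: "interleave c a b d \<longleftrightarrow> interleave a c b d" "interleave a c d b \<longleftrightarrow> interleave a c b d"
  by (simp_all add: interleave_def min.commute max.commute)

lemma interleave_cases:
  "interleave a c b d \<longleftrightarrow>
     a < b \<and> b < c \<and> c < d \<or> a < d \<and> d < c \<and> c < b \<or>
     c < b \<and> b < a \<and> a < d \<or> c < d \<and> d < a \<and> a < b \<or>
     b < a \<and> a < d \<and> d < c \<or> b < c \<and> c < d \<and> d < a \<or>
     d < a \<and> a < b \<and> b < c \<or> d < c \<and> c < b \<and> b < a"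
  by (auto simp: interleave_def min_def max_def)

lemma interleave_distinct: "interleave a c b d \<Longrightarrow> a \<noteq> c \<and> a \<noteq> b \<and> a \<noteq> d \<and> c \<noteq> b \<and> c \<noteq> d \<and> b \<noteq> d"
  by (auto simp: interleave_cases)

lemma interleave_less:
  "a < c \<Longrightarrow> b < d \<Longrightarrow> interleave a c b d \<longleftrightarrow> a < b \<and> b < c \<and> c < d \<or> b < a \<and> a < d \<and> d < c"
  by (auto simp: interleave_def min_def max_def)

lemma interleave_first:
  "a < c \<Longrightarrow> a \<le> b \<Longrightarrow> a \<le> d \<Longrightarrow> interleave a c b d \<longleftrightarrow> a < b \<and> b < c \<and> c < d \<or> a < d \<and> d < c \<and> c < b"
  by (auto simp: interleave_def min_def max_def)

text \<open>The factor \<open>(x - b) * (x - d)\<close> is negative exactly when \<open>x\<close>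
  lies strictly between \<open>b\<close> and \<open>d\<close>. This sign form is the one that can be
  compared with products of complex differences on the circle.\<close>

lemma interleave_iff_prod_neg:
  fixes a b c d :: real
  shows "interleave a c b d \<longleftrightarrow> (a - b) * (a - d) * ((c - b) * (c - d)) < 0"
proof -
  have 1: "(x - b) * (x - d) < 0 \<longleftrightarrow> b < x \<and> x < d \<or> d < x \<and> x < b" for x
    by (auto simp: mult_less_0_iff)
  have 2: "(x - b) * (x - d) > 0 \<longleftrightarrow> x < b \<and> x < d \<or> d < x \<and> b < x" for x
    by (auto simp: zero_less_mult_iff)
  show ?thesis unfolding mult_less_0_iff[of "(a - b) * (a - d)"] 1 2 interleave_cases
    by auto
qed

text \<open>Exactly one of \<open>b\<close>, \<open>d\<close> lies between \<open>a\<close> and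
  \<open>c\<close>. In this parity form every point enters two comparisons, so that reversals come
  in cancelling pairs.\<close>

lemma interleave_xor:
  "interleave a c b d \<longleftrightarrow> a \<noteq> b \<and> a \<noteq> d \<and> c \<noteq> b \<and> c \<noteq> d \<and> ((a < b) \<noteq> (c < b)) \<noteq> ((a < d) \<noteq> (c < d))"
  by (cases a c rule: linorder_cases; cases b d rule: linorder_cases)
    (auto simp: interleave_less interleave_swap(1)[of a c] interleave_swap(2)[of _ _ d b] interleave_def)

lemma interleave_separated:
  "a \<le> z \<Longrightarrow> c \<le> z \<Longrightarrow> z \<le> b \<Longrightarrow> z \<le> d \<Longrightarrow> \<not> interleave a c b d"
proof -
  assume "a \<le> z" "c \<le> z" "z \<le> b" "z \<le> d"
  then have "max a c \<le> min b d" "min b d \<le> max b d" by (auto intro: order.trans simp: min_le_iff_disj)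
  then have "\<not> min b d < max a c" "\<not> max b d < max a c" by order+
  then show ?thesis by (simp add: interleave_def)
qed

text \<open>Opening a cyclic order at another place moves the points marked by \<open>P\<close> to
  the other end, which reverses a comparison iff just one of its two points is marked. In
  \<open>interleave_xor\<close> each of the four marks occurs twice and cancels.\<close>

lemma interleave_rotate:
  fixes f :: "'b::linorder \<Rightarrow> 'c::linorder" and P :: "'b \<Rightarrow> bool"
  assumes "\<And>x y. x \<in> {a, c} \<Longrightarrow> y \<in> {b, d} \<Longrightarrow> x \<noteq> y \<Longrightarrow>
     f x \<noteq> f y \<and> (f x < f y \<longleftrightarrow> (x < y) \<noteq> (P x \<noteq> P y))"
  shows "interleave (f a) (f c) (f b) (f d) \<longleftrightarrow> interleave a c b d"
proof (cases "a = b \<or> a = d \<or> c = b \<or> c = d")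
  case True
  then show ?thesis by (auto dest: interleave_distinct)
next
  case False
  then have f: "f x \<noteq> f y" "f x < f y \<longleftrightarrow> (x < y) \<noteq> (P x \<noteq> P y)" if "x \<in> {a, c}" "y \<in> {b, d}" for x y
    using assms[OF that] that by blast+
  have ne: "f a \<noteq> f b" "f a \<noteq> f d" "f c \<noteq> f b" "f c \<noteq> f d" and less:
    "f a < f b \<longleftrightarrow> (a < b) \<noteq> (P a \<noteq> P b)" "f a < f d \<longleftrightarrow> (a < d) \<noteq> (P a \<noteq> P d)"
    "f c < f b \<longleftrightarrow> (c < b) \<noteq> (P c \<noteq> P b)" "f c < f d \<longleftrightarrow> (c < d) \<noteq> (P c \<noteq> P d)"
    by (simp_all add: f)
  have "(((f a < f b) \<noteq> (f c < f b)) \<noteq> ((f a < f d) \<noteq> (f c < f d))) =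
      (((a < b) \<noteq> (c < b)) \<noteq> ((a < d) \<noteq> (c < d)))"
  proof -
    have "(((w \<noteq> (p \<noteq> q)) \<noteq> (x \<noteq> (r \<noteq> q))) \<noteq> ((y \<noteq> (p \<noteq> s)) \<noteq> (z \<noteq> (r \<noteq> s)))) = ((w \<noteq> x) \<noteq> (y \<noteq> z))"
      for p q r s w x y z :: bool
      by (cases p; cases q; cases r; cases s; cases w; cases x; cases y; cases z) simp_all
    then show ?thesis unfolding less .
  qed
  then show ?thesis
    using False ne unfolding interleave_xor by simp
qed

lemma interleave_mono_on:
  assumes "\<And>x y. x \<in> {a, c} \<Longrightarrow> y \<in> {b, d} \<Longrightarrow> f x < f y \<longleftrightarrow> x < y"
    and "\<And>x y. x \<in> {a, c} \<Longrightarrow> y \<in> {b, d} \<Longrightarrow> f x = f y \<longleftrightarrow> x = y"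
  shows "interleave (f a) (f c) (f b) (f d) \<longleftrightarrow> interleave a c b d"
  unfolding interleave_xor using assms by simp

lemma interleave_uminus:
  fixes a b c d :: real
  shows "interleave (- a) (- c) (- b) (- d) \<longleftrightarrow> interleave a c b d"
  by (auto simp: interleave_xor)

text \<open>On a circle, joining opposite points is the pairing that crosses. This gives every K_4 a
  crossing pair in whatever order.\<close>

lemma interleave_pairing:
  fixes a b c d :: "'b::linorder"
  assumes "a \<noteq> b" "a \<noteq> c" "a \<noteq> d" "b \<noteq> c" "b \<noteq> d" "c \<noteq> d"
  shows "interleave a b c d \<or> interleave a c b d \<or> interleave a d b c"
proof -
  have r: "c < b \<longleftrightarrow> \<not> b < c" "d < b \<longleftrightarrow> \<not> b < d" "d < c \<longleftrightarrow> \<not> c < d"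
    using assms by auto
  show ?thesis unfolding interleave_xor r using assms
    by (cases "a < b"; cases "a < c"; cases "a < d"; cases "b < c"; cases "b < d"; cases "c < d") simp_all
qed

section \<open>Paths in a disk\<close>

text \<open>The ends alternate on the bottom edge of a box containing both paths, the situation of
  \<open>fashoda_interlace\<close>; \<open>V\<close> only changes from complex numbers to
  vectors.\<close>

lemma half_plane_paths_meet_ordered:
  fixes f g :: "real \<Rightarrow> complex"
  assumes "path f" "path g"
    and im: "\<And>z. z \<in> path_image f \<union> path_image g \<Longrightarrow> 0 \<le> Im z"
    and "Im (pathstart f) = 0" "Im (pathfinish f) = 0" "Im (pathstart g) = 0" "Im (pathfinish g) = 0"
    and "Re (pathstart f) < Re (pathstart g)" "Re (pathstart g) < Re (pathfinish f)"
        "Re (pathfinish f) < Re (pathfinish g)"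
  shows "path_image f \<inter> path_image g \<noteq> {}"
proof -
  define V :: "complex \<Rightarrow> real^2" where "V z = (\<chi> i. if i = 1 then Re z else Im z)" for z
  have V1: "V z $ 1 = Re z" and V2: "V z $ 2 = Im z" for z by (simp_all add: V_def)
  have contV: "continuous_on A V" for A
    unfolding V_def
  proof (rule continuous_on_vec_lambda)
    show "continuous_on A (\<lambda>z. if i = 1 then Re z else Im z)" for i :: 2
      by (cases "i = 1") (auto intro: continuous_intros)
  qed
  have injV: "V z = V w \<Longrightarrow> z = w" for z w
    by (metis V1 V2 complex_eqI)
  have "bounded (path_image f \<union> path_image g)"
    using assms by (simp add: bounded_path_image)
  then obtain M where M: "\<And>z. z \<in> path_image f \<union> path_image g \<Longrightarrow> norm z \<le> M"
    by (auto simp: bounded_iff)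
  define a :: "real^2" where "a = vector [-M, 0]"
  define b :: "real^2" where "b = vector [M, M]"
  have box: "V z \<in> cbox a b" if "z \<in> path_image f \<union> path_image g" for z
    using M[OF that] im[OF that] abs_Re_le_cmod[of z] abs_Im_le_cmod[of z]
    by (auto simp: mem_box_cart forall_2 V1 V2 a_def b_def)
  have pf: "path (V \<circ> f)" "path (V \<circ> g)"
    using assms(1,2) contV by (auto intro!: path_continuous_image)
  obtain z where "z \<in> path_image (V \<circ> f)" "z \<in> path_image (V \<circ> g)"
  proof (rule fashoda_interlace[of "V \<circ> f" "V \<circ> g" a b])
    show "path_image (V \<circ> f) \<subseteq> cbox a b" "path_image (V \<circ> g) \<subseteq> cbox a b"
      using box by (auto simp: path_image_compose)
  qed (use assms pf in \<open>auto simp: pathstart_compose pathfinish_compose V1 V2 a_def\<close>)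
  then show ?thesis using injV by (auto simp: path_image_compose)
qed

lemma half_plane_paths_meet:
  fixes f g :: "real \<Rightarrow> complex"
  assumes "path f" "path g"
    and "\<And>z. z \<in> path_image f \<union> path_image g \<Longrightarrow> 0 \<le> Im z"
    and "Im (pathstart f) = 0" "Im (pathfinish f) = 0" "Im (pathstart g) = 0" "Im (pathfinish g) = 0"
    and il: "interleave (Re (pathstart f)) (Re (pathfinish f)) (Re (pathstart g)) (Re (pathfinish g))"
  shows "path_image f \<inter> path_image g \<noteq> {}"
proof -
  note H = half_plane_paths_meet_ordered
  \<comment> \<open>Exchanging the two paths and reversing either of them reduces the eight
    alternating orders of the ends to a single one.\<close>
  have *: "path_image f' \<inter> path_image g' \<noteq> {} \<and> path_image g' \<inter> path_image f' \<noteq> {}"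
    if "f' = f \<and> g' = g \<or> f' = g \<and> g' = f"
      "Re (pathstart f') < Re (pathstart g') \<and> Re (pathstart g') < Re (pathfinish f') \<and> Re (pathfinish f') < Re (pathfinish g') \<or>
       Re (pathstart f') < Re (pathfinish g') \<and> Re (pathfinish g') < Re (pathfinish f') \<and> Re (pathfinish f') < Re (pathstart g') \<or>
       Re (pathfinish f') < Re (pathstart g') \<and> Re (pathstart g') < Re (pathstart f') \<and> Re (pathstart f') < Re (pathfinish g') \<or>
       Re (pathfinish f') < Re (pathfinish g') \<and> Re (pathfinish g') < Re (pathstart f') \<and> Re (pathstart f') < Re (pathstart g')"
    for f' g'
    using that(2)
  proof (elim disjE)
    assume "Re (pathstart f') < Re (pathstart g') \<and> Re (pathstart g') < Re (pathfinish f') \<and> Re (pathfinish f') < Re (pathfinish g')"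
    then show ?thesis using that(1) assms H[of f' g'] by auto
  next
    assume "Re (pathstart f') < Re (pathfinish g') \<and> Re (pathfinish g') < Re (pathfinish f') \<and> Re (pathfinish f') < Re (pathstart g')"
    then show ?thesis using that(1) assms H[of f' "reversepath g'"] by auto
  next
    assume "Re (pathfinish f') < Re (pathstart g') \<and> Re (pathstart g') < Re (pathstart f') \<and> Re (pathstart f') < Re (pathfinish g')"
    then show ?thesis using that(1) assms H[of "reversepath f'" g'] by auto
  next
    assume "Re (pathfinish f') < Re (pathfinish g') \<and> Re (pathfinish g') < Re (pathstart f') \<and> Re (pathstart f') < Re (pathstart g')"
    then show ?thesis using that(1) assms H[of "reversepath f'" "reversepath g'"] by auto
  qed
  show ?thesis
    using il *[of f g] *[of g f] unfolding interleave_cases by blast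
qed

section \<open>The Cayley transform from the disk to the half plane\<close>

lemma Cayley_Im: "z \<noteq> 1 \<Longrightarrow> Im (\<i> * (1 + z) / (1 - z)) = (1 - (norm z)\<^sup>2) / (norm (1 - z))\<^sup>2"
  using cmod_power2[of z] unfolding Im_divide' by (simp add: power2_eq_square algebra_simps)

lemma Cayley_diff:
  fixes a b :: complex
  assumes "a \<noteq> 1" "b \<noteq> 1"
  shows "\<i> * (1 + a) / (1 - a) - \<i> * (1 + b) / (1 - b) = 2 * \<i> * (a - b) / ((1 - a) * (1 - b))"
  using assms by (simp add: field_simps)

text \<open>On the unit circle the conjugate of \<open>a\<close> is its inverse, so
  \<open>(1 - a)\<^sup>2 / a\<close> is a negative real number. This makes the denominators left by
  \<open>Cayley_diff\<close> positive multiples of \<open>a * b * c * d\<close>.\<close>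

lemma unit_one_minus_square:
  fixes a :: complex
  assumes "norm a = 1"
  shows "(1 - a)\<^sup>2 = - a * of_real ((norm (1 - a))\<^sup>2)"
proof -
  have "a * cnj a = 1" using assms by (simp add: complex_norm_square[symmetric])
  then show ?thesis
    unfolding complex_norm_square by (simp add: power2_eq_square algebra_simps)
qed

text \<open>The quotient is real. The Cayley transform maps the disk without \<open>1\<close> into the upper half plane
  and turns the quotient, up to a positive factor, into the product of \<open>interleave_iff_prod_neg\<close>.\<close>

lemma disk_paths_meet_avoiding_1:
  fixes g h :: "real \<Rightarrow> complex"
  assumes "path g" "path h" "path_image g \<subseteq> cball 0 1" "path_image h \<subseteq> cball 0 1"
    and g: "pathstart g = a" "pathfinish g = c" and h: "pathstart h = b" "pathfinish h = d"
    and n: "norm a = 1" "norm b = 1" "norm c = 1" "norm d = 1"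
    and X: "Re ((a - b) * (a - d) * ((c - b) * (c - d)) / (a * b * c * d)) < 0"
    and 1: "1 \<notin> path_image g" "1 \<notin> path_image h"
  shows "path_image g \<inter> path_image h \<noteq> {}"
proof -
  define k where "k z = \<i> * (1 + z) / (1 - z)" for z :: complex
  have ne: "a \<noteq> 1" "b \<noteq> 1" "c \<noteq> 1" "d \<noteq> 1"
    using 1 g h pathstart_in_path_image pathfinish_in_path_image by metis+
  have cont: "continuous_on (- {1}) k" unfolding k_def by (auto intro!: continuous_intros)
  have inj: "z = w" if "k z = k w" "z \<noteq> 1" "w \<noteq> 1" for z w
    using that Cayley_diff[of z w] by (auto simp: k_def)
  have Im0: "Im (k z) = 0" if "z \<noteq> 1" "norm z = 1" for z
    using that by (simp add: k_def Cayley_Im)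
  have Im1: "Im (k z) \<ge> 0" if "z \<noteq> 1" "norm z \<le> 1" for z
    using that by (simp add: k_def Cayley_Im power_le_one)
  define P where "P = (norm (1 - a))\<^sup>2 * (norm (1 - b))\<^sup>2 * (norm (1 - c))\<^sup>2 * (norm (1 - d))\<^sup>2"
  have P: "P > 0" using ne by (auto simp: P_def)
  define Q where "Q = (a - b) * (a - d) * ((c - b) * (c - d))"
  have *: "(2 * \<i> * x / (p * q)) * (2 * \<i> * y / (p * s)) * ((2 * \<i> * z / (r * q)) * (2 * \<i> * w / (r * s))) =
      (2 * \<i>)^4 * (x * y * (z * w)) / (p\<^sup>2 * q\<^sup>2 * r\<^sup>2 * s\<^sup>2)" for x y z w p q r s
    by (simp add: power2_eq_square power4_eq_xxxx mult_ac)
  \<comment> \<open>Each point occurs in two of the four differences, so its factor in the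
    denominator is a square; the four minus signs cancel and \<open>(2 * \<i>)^4\<close> is
    16.\<close>
  have "(k a - k b) * (k a - k d) * ((k c - k b) * (k c - k d)) =
      (2 * \<i>)^4 * Q / ((1 - a)\<^sup>2 * (1 - b)\<^sup>2 * (1 - c)\<^sup>2 * (1 - d)\<^sup>2)"
    unfolding k_def Cayley_diff[OF ne(1,2)] Cayley_diff[OF ne(1,4)] Cayley_diff[OF ne(3,2)] Cayley_diff[OF ne(3,4)]
    Q_def by (rule *)
  also have "\<dots> = of_real (16 / P) * (Q / (a * b * c * d))"
    unfolding unit_one_minus_square[OF n(1)] unit_one_minus_square[OF n(2)]
      unit_one_minus_square[OF n(3)] unit_one_minus_square[OF n(4)]
    by (simp add: P_def power_mult_distrib field_simps)
  finally have "Re ((k a - k b) * (k a - k d) * ((k c - k b) * (k c - k d))) = 16 / P * Re (Q / (a * b * c * d))"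
    by (metis Re_complex_of_real times_complex.sel(1) Im_complex_of_real mult_zero_left diff_zero)
  moreover have "Re ((k a - k b) * (k a - k d) * ((k c - k b) * (k c - k d))) =
     (Re (k a) - Re (k b)) * (Re (k a) - Re (k d)) * ((Re (k c) - Re (k b)) * (Re (k c) - Re (k d)))"
    using Im0 ne n by simp
  moreover have "16 / P * Re (Q / (a * b * c * d)) < 0"
    using X P by (intro mult_pos_neg) (simp_all add: Q_def)
  ultimately have il: "interleave (Re (k a)) (Re (k c)) (Re (k b)) (Re (k d))"
    unfolding interleave_iff_prod_neg by linarith
  have sub: "path_image g \<subseteq> - {1}" "path_image h \<subseteq> - {1}" using 1 by auto
  have "path_image (k \<circ> g) \<inter> path_image (k \<circ> h) \<noteq> {}"
  proof (rule half_plane_paths_meet)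
    show "path (k \<circ> g)" "path (k \<circ> h)"
      using assms(1,2) cont sub by (auto intro!: path_continuous_image elim: continuous_on_subset)
    show "0 \<le> Im z" if "z \<in> path_image (k \<circ> g) \<union> path_image (k \<circ> h)" for z
      using that sub assms(3,4) Im1 by (auto simp: path_image_compose subset_iff)
  qed (use il g h Im0 ne n in \<open>simp_all add: pathstart_compose pathfinish_compose\<close>)
  then obtain z w where "z \<in> path_image g" "w \<in> path_image h" "k z = k w"
    by (auto simp: path_image_compose)
  with inj sub show ?thesis by blast
qed

text \<open>A point of the circle missed by both paths can be rotated to 1, and the quotient is
  unchanged because numerator and denominator both have degree four. If no point is missed, two
  nonempty closed sets cover the circle, and they meet because it is connected.\<close>

lemma disk_paths_meet:
  fixes g h :: "real \<Rightarrow> complex"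
  assumes "path g" "path h" "path_image g \<subseteq> cball 0 1" "path_image h \<subseteq> cball 0 1"
    and g: "pathstart g = a" "pathfinish g = c" and h: "pathstart h = b" "pathfinish h = d"
    and n: "norm a = 1" "norm b = 1" "norm c = 1" "norm d = 1"
    and X: "Re ((a - b) * (a - d) * ((c - b) * (c - d)) / (a * b * c * d)) < 0"
  shows "path_image g \<inter> path_image h \<noteq> {}"
proof (cases "sphere 0 1 \<subseteq> path_image g \<union> path_image h")
  case True
  have "connected (sphere (0::complex) 1)" by (rule connected_sphere) simp
  moreover have "closed (path_image g)" "closed (path_image h)"
    using assms by (simp_all add: closed_path_image)
  moreover have "a \<in> path_image g \<inter> sphere 0 1" "b \<in> path_image h \<inter> sphere 0 1"
    using g h n by auto
  ultimately show ?thesis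
    using True unfolding connected_closed by blast
next
  case False
  then obtain z0 where "z0 \<in> sphere 0 1" and z0: "z0 \<notin> path_image g" "z0 \<notin> path_image h" by blast
  then have nz0: "norm z0 = 1" by simp
  define m where "m z = z / z0" for z
  have z00: "z0 \<noteq> 0" using nz0 by auto
  have cont: "continuous_on A m" for A unfolding m_def using z00 by (auto intro!: continuous_intros)
  have inj: "m z = m w \<Longrightarrow> z = w" for z w using z00 by (simp add: m_def)
  have nm: "norm (m z) = norm z" for z using nz0 by (simp add: m_def norm_divide)
  have m1: "m z = 1 \<longleftrightarrow> z = z0" for z using z00 by (auto simp: m_def)
  have "path_image (m \<circ> g) \<inter> path_image (m \<circ> h) \<noteq> {}"
  proof (rule disk_paths_meet_avoiding_1)
    show "path (m \<circ> g)" "path (m \<circ> h)" using assms(1,2) cont by (auto intro!: path_continuous_image)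
    show "path_image (m \<circ> g) \<subseteq> cball 0 1" "path_image (m \<circ> h) \<subseteq> cball 0 1"
      using assms(3,4) nm by (auto simp: path_image_compose)
    show "1 \<notin> path_image (m \<circ> g)" "1 \<notin> path_image (m \<circ> h)"
      using z0 m1 by (force simp: path_image_compose)+
    have "(m a - m b) * (m a - m d) * ((m c - m b) * (m c - m d)) / (m a * m b * m c * m d)
      = (a - b) * (a - d) * ((c - b) * (c - d)) / (a * b * c * d)"
      using z00 by (simp add: m_def diff_divide_distrib[symmetric])
    then show "Re ((m a - m b) * (m a - m d) * ((m c - m b) * (m c - m d)) / (m a * m b * m c * m d)) < 0"
      using X by simp
  qed (use g h nm n in \<open>auto simp: pathstart_compose pathfinish_compose\<close>)
  then show ?thesis using inj by (auto simp: path_image_compose)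
qed

section \<open>Points of the circle by their angles\<close>

lemma cis_diff: "cis x - cis y = 2 * \<i> * of_real (sin ((x - y) / 2)) * cis ((x + y) / 2)"
proof -
  have "cis x = cis ((x + y) / 2) * cis ((x - y) / 2)" "cis y = cis ((x + y) / 2) * cis (- ((x - y) / 2))"
    by (simp_all add: cis_mult field_simps)
  moreover have "cis t - cis (- t) = 2 * \<i> * of_real (sin t)" for t
    by (simp add: complex_eq_iff)
  ultimately show ?thesis by (metis mult.commute right_diff_distrib')
qed

text \<open>The bound places \<open>t / 2\<close> strictly between -\<pi> and \<pi>, where sine has
  the sign of its argument.\<close>

lemma sgn_sin_half:
  fixes t :: real
  assumes "\<bar>t\<bar> < 2 * pi"
  shows "sgn (sin (t / 2)) = sgn t"
proof -
  consider "t > 0" | "t = 0" | "t < 0" by linarith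
  then show ?thesis
  proof cases
    case 1 then show ?thesis using assms sin_gt_zero[of "t/2"] by simp
  next
    case 3 then show ?thesis using assms sin_gt_zero[of "-t/2"] by simp
  qed simp
qed

text \<open>By \<open>cis_diff\<close> the phases of the four differences multiply to the
  denominator, leaving 16 times a product of half-angle sines. Its sign is that of the product in
  \<open>interleave_iff_prod_neg\<close>.\<close>

lemma disk_paths_meet_angles:
  fixes g h :: "real \<Rightarrow> complex"
  assumes "path g" "path h" "path_image g \<subseteq> cball 0 1" "path_image h \<subseteq> cball 0 1"
    and "pathstart g = cis \<alpha>" "pathfinish g = cis \<gamma>" "pathstart h = cis \<beta>" "pathfinish h = cis \<delta>"
    and r: "\<bar>\<alpha> - \<beta>\<bar> < 2 * pi" "\<bar>\<alpha> - \<delta>\<bar> < 2 * pi" "\<bar>\<gamma> - \<beta>\<bar> < 2 * pi" "\<bar>\<gamma> - \<delta>\<bar> < 2 * pi"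
    and il: "interleave \<alpha> \<gamma> \<beta> \<delta>"
  shows "path_image g \<inter> path_image h \<noteq> {}"
proof (rule disk_paths_meet)
  let ?s = "\<lambda>x y. sin ((x - y) / 2)"
  have e: "cis ((\<alpha> + \<beta>) / 2) * cis ((\<alpha> + \<delta>) / 2) * (cis ((\<gamma> + \<beta>) / 2) * cis ((\<gamma> + \<delta>) / 2))
      = cis \<alpha> * cis \<beta> * cis \<gamma> * cis \<delta>"
    unfolding cis_mult by (rule arg_cong[of _ _ cis]) (simp add: field_simps)
  have "(cis \<alpha> - cis \<beta>) * (cis \<alpha> - cis \<delta>) * ((cis \<gamma> - cis \<beta>) * (cis \<gamma> - cis \<delta>))
     = of_real (16 * (?s \<alpha> \<beta> * ?s \<alpha> \<delta> * (?s \<gamma> \<beta> * ?s \<gamma> \<delta>))) * (cis ((\<alpha> + \<beta>) / 2) * cis ((\<alpha> + \<delta>) / 2) * (cis ((\<gamma> + \<beta>) / 2) * cis ((\<gamma> + \<delta>) / 2)))"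
    unfolding cis_diff by (simp add: algebra_simps)
  then have *: "(cis \<alpha> - cis \<beta>) * (cis \<alpha> - cis \<delta>) * ((cis \<gamma> - cis \<beta>) * (cis \<gamma> - cis \<delta>)) / (cis \<alpha> * cis \<beta> * cis \<gamma> * cis \<delta>)
     = of_real (16 * (?s \<alpha> \<beta> * ?s \<alpha> \<delta> * (?s \<gamma> \<beta> * ?s \<gamma> \<delta>)))"
    unfolding e by simp
  have "sgn (?s \<alpha> \<beta> * ?s \<alpha> \<delta> * (?s \<gamma> \<beta> * ?s \<gamma> \<delta>)) = sgn ((\<alpha> - \<beta>) * (\<alpha> - \<delta>) * ((\<gamma> - \<beta>) * (\<gamma> - \<delta>)))"
    by (simp only: sgn_mult sgn_sin_half r)
  then have "?s \<alpha> \<beta> * ?s \<alpha> \<delta> * (?s \<gamma> \<beta> * ?s \<gamma> \<delta>) < 0"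
    using il unfolding interleave_iff_prod_neg by (metis sgn_less)
  then show "Re ((cis \<alpha> - cis \<beta>) * (cis \<alpha> - cis \<delta>) * ((cis \<gamma> - cis \<beta>) * (cis \<gamma> - cis \<delta>)) / (cis \<alpha> * cis \<beta> * cis \<gamma> * cis \<delta>)) < 0"
    unfolding * Re_complex_of_real by simp
qed (use assms in auto)

section \<open>Drawings and vertex orders\<close>

definition crosses :: "('a \<Rightarrow> 'b::linorder) \<Rightarrow> 'a set \<Rightarrow> 'a set \<Rightarrow> bool" where
  "crosses p e f \<longleftrightarrow> (\<exists>a c b d. e = {a, c} \<and> f = {b, d} \<and> interleave (p a) (p c) (p b) (p d))"

definition one_crossing_order :: "('a \<Rightarrow> 'b::linorder) \<Rightarrow> 'a graph \<Rightarrow> bool" where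
  "one_crossing_order p G \<longleftrightarrow> inj_on p (verts G) \<and>
     (\<forall>e\<in>edges G. \<forall>f\<in>edges G. \<forall>g\<in>edges G. crosses p e f \<and> crosses p e g \<longrightarrow> f = g)"

lemma crosses_doubleton [simp]: "crosses p {a, c} {b, d} \<longleftrightarrow> interleave (p a) (p c) (p b) (p d)"
  unfolding crosses_def doubleton_eq_iff by (auto simp: interleave_swap)

lemma crosses_sym: "crosses p e f \<longleftrightarrow> crosses p f e"
  unfolding crosses_def using interleave_sym by blast

lemma crosses_disjoint: "crosses p e f \<Longrightarrow> e \<inter> f = {}"
  unfolding crosses_def using interleave_distinct by fast

lemma crosses_ne: "crosses p e f \<Longrightarrow> e \<noteq> f"
  unfolding crosses_def by (auto simp: doubleton_eq_iff dest!: interleave_distinct)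

lemma crosses_cong:
  assumes "\<And>a c b d. {a, c, b, d} \<subseteq> V \<Longrightarrow> interleave (p a) (p c) (p b) (p d) \<longleftrightarrow> interleave (q a) (q c) (q b) (q d)"
    and "e \<subseteq> V" "f \<subseteq> V"
  shows "crosses p e f \<longleftrightarrow> crosses q e f"
proof -
  have "interleave (p a) (p c) (p b) (p d) \<longleftrightarrow> interleave (q a) (q c) (q b) (q d)"
    if "e = {a, c}" "f = {b, d}" for a b c d
    using assms(2,3) that by (intro assms(1)) auto
  then show ?thesis unfolding crosses_def by blast
qed

lemma one_crossing_order_subgraph: "one_crossing_order p G \<Longrightarrow> subgraph B G \<Longrightarrow> one_crossing_order p B"
  unfolding one_crossing_order_def subgraph_def
proof (intro conjI ballI impI)
  fix e f g assume *: "inj_on p (verts G) \<and>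
      (\<forall>e\<in>edges G. \<forall>f\<in>edges G. \<forall>g\<in>edges G. crosses p e f \<and> crosses p e g \<longrightarrow> f = g)"
    and B: "simple_graph B \<and> verts B \<subseteq> verts G \<and> edges B \<subseteq> edges G"
    and "e \<in> edges B" "f \<in> edges B" "g \<in> edges B"
  then have "e \<in> edges G" "f \<in> edges G" "g \<in> edges G" by auto
  then show "f = g" if "crosses p e f \<and> crosses p e g" using * that by simp
qed (auto intro: inj_on_subset)

text \<open>The curves must meet, and not in a vertex: a curve contains no vertices but its own
  ends, and interleaving edges have no common end. The angles \<open>Arg\<close> lie in a half-open
  interval of length 2 \<pi>, hence differ by less than a full turn.\<close>

lemma disk_drawing_crosses:
  assumes S: "simple_graph B" and D: "disk_drawing B d" and e: "e \<in> edges B" and f: "f \<in> edges B"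
    and c: "crosses (\<lambda>v. Arg (point_of d v)) e f"
  shows "crossing_points B d e f \<noteq> {}"
proof -
  from c obtain a c b d' where ef: "e = {a, c}" "f = {b, d'}"
    and il: "interleave (Arg (point_of d a)) (Arg (point_of d c)) (Arg (point_of d b)) (Arg (point_of d d'))"
    unfolding crosses_def by blast
  have V: "e \<subseteq> verts B" "f \<subseteq> verts B" using S e f by (auto simp: simple_graph_def)
  have n: "norm (point_of d v) = 1" if "v \<in> verts B" for v
    using D that by (auto simp: disk_drawing_def)
  have cis: "cis (Arg (point_of d v)) = point_of d v" if "v \<in> verts B" for v
    using n[OF that] by (metis cis_Arg div_by_1 norm_zero of_real_1 sgn_eq zero_neq_one)
  have r: "\<bar>Arg z - Arg w\<bar> < 2 * pi" for z w
    using Arg_bounded[of z] Arg_bounded[of w] by auto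
  let ?g = "curve_of d e" and ?h = "curve_of d f"
  have gh: "path ?g" "path ?h" "path_image ?g \<subseteq> cball 0 1" "path_image ?h \<subseteq> cball 0 1"
    "{pathstart ?g, pathfinish ?g} = {point_of d a, point_of d c}"
    "{pathstart ?h, pathfinish ?h} = {point_of d b, point_of d d'}"
    "path_image ?g \<inter> point_of d ` verts B = point_of d ` e"
    "path_image ?h \<inter> point_of d ` verts B = point_of d ` f"
    using D e f unfolding disk_drawing_def by (auto simp: ef arc_imp_path)
  obtain a' c' where a': "pathstart ?g = point_of d a'" "pathfinish ?g = point_of d c'"
    "a' = a \<and> c' = c \<or> a' = c \<and> c' = a"
    using gh(5) by (auto simp: doubleton_eq_iff)
  obtain b' e' where b': "pathstart ?h = point_of d b'" "pathfinish ?h = point_of d e'"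
    "b' = b \<and> e' = d' \<or> b' = d' \<and> e' = b"
    using gh(6) by (auto simp: doubleton_eq_iff)
  have il': "interleave (Arg (point_of d a')) (Arg (point_of d c')) (Arg (point_of d b')) (Arg (point_of d e'))"
    using il a'(3) b'(3) by (elim disjE) (simp_all add: interleave_swap)
  have "a' \<in> verts B" "c' \<in> verts B" "b' \<in> verts B" "e' \<in> verts B"
    using a'(3) b'(3) V ef by auto
  then have "path_image ?g \<inter> path_image ?h \<noteq> {}"
    by (intro disk_paths_meet_angles[OF gh(1-4) _ _ _ _ r r r r il']) (simp_all add: cis a' b')
  then obtain z where z: "z \<in> path_image ?g" "z \<in> path_image ?h" by auto
  have "z \<notin> point_of d ` verts B"
  proof
    assume "z \<in> point_of d ` verts B"
    then have "z \<in> point_of d ` e" "z \<in> point_of d ` f" using gh(7,8) z by auto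
    moreover have "inj_on (point_of d) (verts B)" using D by (simp add: disk_drawing_def)
    moreover have "e \<inter> f = {}" using c by (rule crosses_disjoint)
    ultimately show False using V unfolding inj_on_def by blast
  qed
  with z show ?thesis by (auto simp: crossing_points_def)
qed

lemma pseudo_outerplanar_drawing_at_most_one:
  assumes S: "simple_graph B" and D: "pseudo_outerplanar_drawing B d"
    and e: "e \<in> edges B" and f: "f \<in> edges B" and g: "g \<in> edges B"
    and "f \<noteq> e" "g \<noteq> e" "crossing_points B d e f \<noteq> {}" "crossing_points B d e g \<noteq> {}"
  shows "f = g"
proof -
  have "edges B \<subseteq> Pow (verts B)" using S by (auto simp: simple_graph_def)
  then have "finite (edges B)" using S by (auto simp: simple_graph_def intro: finite_subset)
  then have fin: "finite {f \<in> edges B. f \<noteq> e \<and> crossing_points B d e f \<noteq> {}}" by simp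
  have "card {f \<in> edges B. f \<noteq> e \<and> crossing_points B d e f \<noteq> {}} \<le> Suc 0"
    using D e by (auto simp: pseudo_outerplanar_drawing_def)
  with assms show ?thesis unfolding card_le_Suc0_iff_eq[OF fin] by blast
qed

lemma pseudo_outerplanar_drawing_one_crossing_order:
  assumes S: "simple_graph B" and D: "pseudo_outerplanar_drawing B d"
  shows "one_crossing_order (\<lambda>v. Arg (point_of d v)) B"
  unfolding one_crossing_order_def
proof (intro conjI ballI impI)
  have dd: "disk_drawing B d" using D by (simp add: pseudo_outerplanar_drawing_def)
  show "inj_on (\<lambda>v. Arg (point_of d v)) (verts B)"
  proof (rule inj_onI)
    fix u v assume uv: "u \<in> verts B" "v \<in> verts B" "Arg (point_of d u) = Arg (point_of d v)"
    have "norm (point_of d u) = 1" "norm (point_of d v) = 1"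
      using dd uv by (auto simp: disk_drawing_def)
    then have "point_of d u = point_of d v"
      using uv(3) by (metis rcis_cmod_Arg)
    then show "u = v" using dd uv by (auto simp: disk_drawing_def inj_on_def)
  qed
  fix e f g assume "e \<in> edges B" "f \<in> edges B" "g \<in> edges B"
    and "crosses (\<lambda>v. Arg (point_of d v)) e f \<and> crosses (\<lambda>v. Arg (point_of d v)) e g"
  then show "f = g"
    using pseudo_outerplanar_drawing_at_most_one[OF S D] disk_drawing_crosses[OF S dd] crosses_ne by metis
qed

text \<open>The length of the chord times the signed distance of \<open>z\<close> from the line
  through it.\<close>

definition chord_side :: "real \<Rightarrow> real \<Rightarrow> complex \<Rightarrow> real" where
  "chord_side \<alpha> \<beta> z = Im ((z - cis \<alpha>) * cnj (cis \<beta> - cis \<alpha>))"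

lemma chord_side_cis:
  "chord_side \<alpha> \<beta> (cis \<gamma>) = 4 * (sin ((\<gamma> - \<alpha>) / 2) * sin ((\<beta> - \<alpha>) / 2) * sin ((\<gamma> - \<beta>) / 2))"
proof -
  have "(cis \<gamma> - cis \<alpha>) * cnj (cis \<beta> - cis \<alpha>) =
     of_real (4 * sin ((\<gamma> - \<alpha>) / 2) * sin ((\<beta> - \<alpha>) / 2)) * (cis ((\<gamma> + \<alpha>) / 2) * cis (- ((\<beta> + \<alpha>) / 2)))"
    unfolding cis_diff by (simp add: cis_cnj mult_ac)
  also have "cis ((\<gamma> + \<alpha>) / 2) * cis (- ((\<beta> + \<alpha>) / 2)) = cis ((\<gamma> - \<beta>) / 2)"
    unfolding cis_mult by (rule arg_cong[of _ _ cis]) (simp add: field_simps)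
  finally show ?thesis by (simp add: chord_side_def)
qed

lemma chord_side_affine:
  "chord_side \<alpha> \<beta> ((1 - t) *\<^sub>R z + t *\<^sub>R w) = (1 - t) * chord_side \<alpha> \<beta> z + t * chord_side \<alpha> \<beta> w"
  by (simp add: chord_side_def algebra_simps)

lemma chord_side_zero: "z \<in> closed_segment (cis \<alpha>) (cis \<beta>) \<Longrightarrow> chord_side \<alpha> \<beta> z = 0"
  by (auto simp: in_segment chord_side_affine chord_side_cis)

lemma sin_half_ne_0: "\<bar>t\<bar> < 2 * pi \<Longrightarrow> t \<noteq> 0 \<Longrightarrow> sin (t / 2) \<noteq> (0::real)"
  using sgn_sin_half[of t] by (auto simp: sgn_if split: if_splits)

text \<open>Common points are zeros of \<open>chord_side\<close> on the second chord. There it is an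
  affine function of the parameter, and it does not vanish at both ends since one of them is not an
  end of the first chord; so it has at most one zero.\<close>

lemma chords_meet_once:
  assumes r: "\<And>x y. x \<in> {\<alpha>, \<beta>, \<gamma>, \<delta>} \<Longrightarrow> y \<in> {\<alpha>, \<beta>, \<gamma>, \<delta>} \<Longrightarrow> \<bar>x - y\<bar> < 2 * pi"
    and ne: "\<alpha> \<noteq> \<beta>" "\<gamma> \<noteq> \<delta>" "{\<alpha>, \<beta>} \<noteq> {\<gamma>, \<delta>}"
    and z: "z \<in> closed_segment (cis \<alpha>) (cis \<beta>)" "z \<in> closed_segment (cis \<gamma>) (cis \<delta>)"
    and w: "w \<in> closed_segment (cis \<alpha>) (cis \<beta>)" "w \<in> closed_segment (cis \<gamma>) (cis \<delta>)"
  shows "z = w"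
proof -
  let ?s = "chord_side \<alpha> \<beta>"
  obtain t where t: "z = (1 - t) *\<^sub>R cis \<gamma> + t *\<^sub>R cis \<delta>" using z(2) by (auto simp: in_segment)
  obtain u where u: "w = (1 - u) *\<^sub>R cis \<gamma> + u *\<^sub>R cis \<delta>" using w(2) by (auto simp: in_segment)
  have "(1 - t) * ?s (cis \<gamma>) + t * ?s (cis \<delta>) = 0" "(1 - u) * ?s (cis \<gamma>) + u * ?s (cis \<delta>) = 0"
    using chord_side_zero[OF z(1)] chord_side_zero[OF w(1)] by (simp_all add: t u chord_side_affine)
  moreover have "?s (cis \<gamma>) \<noteq> 0 \<or> ?s (cis \<delta>) \<noteq> 0"
  proof -
    have *: "?s (cis x) \<noteq> 0" if "x \<in> {\<gamma>, \<delta>}" "x \<notin> {\<alpha>, \<beta>}" for x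
    proof -
      have "\<bar>x - \<alpha>\<bar> < 2 * pi" "\<bar>\<beta> - \<alpha>\<bar> < 2 * pi" "\<bar>x - \<beta>\<bar> < 2 * pi"
        using that(1) by (auto intro: r)
      then show ?thesis
        using that(2) ne(1) by (simp add: chord_side_cis sin_half_ne_0)
    qed
    have "\<gamma> \<notin> {\<alpha>, \<beta>} \<or> \<delta> \<notin> {\<alpha>, \<beta>}" using ne by auto
    then show ?thesis using * by blast
  qed
  ultimately have "t = u"
  proof -
    assume a: "(1 - t) * ?s (cis \<gamma>) + t * ?s (cis \<delta>) = 0" "(1 - u) * ?s (cis \<gamma>) + u * ?s (cis \<delta>) = 0"
      "?s (cis \<gamma>) \<noteq> 0 \<or> ?s (cis \<delta>) \<noteq> 0"
    have *: "(1 - t) * x + t * y - ((1 - u) * x + u * y) = (t - u) * (y - x)" for x y :: real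
      by (simp add: algebra_simps)
    have "(t - u) * (?s (cis \<delta>) - ?s (cis \<gamma>)) = 0" unfolding *[symmetric] a(1,2) by simp
    moreover have "?s (cis \<delta>) \<noteq> ?s (cis \<gamma>)"
    proof
      assume eq: "?s (cis \<delta>) = ?s (cis \<gamma>)"
      have "(1 - t) * x + t * x = x" for x :: real by (simp add: left_diff_distrib)
      then show False using a(1,3) unfolding eq by metis
    qed
    ultimately show "t = u" by simp
  qed
  then show ?thesis by (simp add: t u)
qed

text \<open>If the ends do not interleave, \<open>chord_side\<close> has the same strict sign at
  both ends of the second chord, hence on all of it, whereas it is zero on the first chord.\<close>

lemma chords_meet_imp_interleave:
  assumes r: "\<And>x y. x \<in> {\<alpha>, \<beta>, \<gamma>, \<delta>} \<Longrightarrow> y \<in> {\<alpha>, \<beta>, \<gamma>, \<delta>} \<Longrightarrow> \<bar>x - y\<bar> < 2 * pi"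
    and ne: "\<alpha> \<noteq> \<beta>" "\<gamma> \<noteq> \<delta>" "{\<alpha>, \<beta>} \<inter> {\<gamma>, \<delta>} = {}"
    and z: "z \<in> closed_segment (cis \<alpha>) (cis \<beta>)" "z \<in> closed_segment (cis \<gamma>) (cis \<delta>)"
  shows "interleave \<alpha> \<beta> \<gamma> \<delta>"
proof (rule ccontr)
  assume "\<not> ?thesis"
  then have "(\<alpha> - \<gamma>) * (\<alpha> - \<delta>) * ((\<beta> - \<gamma>) * (\<beta> - \<delta>)) > 0"
    using ne unfolding interleave_iff_prod_neg not_less by (auto simp: order_less_le)
  then have pos: "(\<gamma> - \<alpha>) * (\<gamma> - \<beta>) * ((\<delta> - \<alpha>) * (\<delta> - \<beta>)) > 0"
    by (simp add: algebra_simps)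
  let ?s = "chord_side \<alpha> \<beta>"
  have "?s (cis \<gamma>) * ?s (cis \<delta>) = (16 * (sin ((\<beta> - \<alpha>) / 2))\<^sup>2) *
      (sin ((\<gamma> - \<alpha>) / 2) * sin ((\<gamma> - \<beta>) / 2) * (sin ((\<delta> - \<alpha>) / 2) * sin ((\<delta> - \<beta>) / 2)))"
    by (simp add: chord_side_cis power2_eq_square)
  moreover have "sgn (sin ((\<gamma> - \<alpha>) / 2) * sin ((\<gamma> - \<beta>) / 2) * (sin ((\<delta> - \<alpha>) / 2) * sin ((\<delta> - \<beta>) / 2)))
     = sgn ((\<gamma> - \<alpha>) * (\<gamma> - \<beta>) * ((\<delta> - \<alpha>) * (\<delta> - \<beta>)))"
    using r by (simp add: sgn_mult sgn_sin_half)
  then have "sin ((\<gamma> - \<alpha>) / 2) * sin ((\<gamma> - \<beta>) / 2) * (sin ((\<delta> - \<alpha>) / 2) * sin ((\<delta> - \<beta>) / 2)) > 0"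
    using pos by (metis sgn_greater)
  moreover have "(sin ((\<beta> - \<alpha>) / 2))\<^sup>2 > 0"
    using sin_half_ne_0[of "\<beta> - \<alpha>"] r ne by simp
  ultimately have pp: "?s (cis \<gamma>) * ?s (cis \<delta>) > 0" by simp
  obtain t where t: "z = (1 - t) *\<^sub>R cis \<gamma> + t *\<^sub>R cis \<delta>" "0 \<le> t" "t \<le> 1" using z(2) by (auto simp: in_segment)
  have 0: "(1 - t) * ?s (cis \<gamma>) + t * ?s (cis \<delta>) = 0"
    using chord_side_zero[OF z(1)] by (simp add: t(1) chord_side_affine)
  have "((1 - t) * ?s (cis \<gamma>) + t * ?s (cis \<delta>)) * ?s (cis \<gamma>) = (1 - t) * (?s (cis \<gamma>))\<^sup>2 + t * (?s (cis \<gamma>) * ?s (cis \<delta>))"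
    by (simp add: algebra_simps power2_eq_square)
  moreover have "(1 - t) * (?s (cis \<gamma>))\<^sup>2 + t * (?s (cis \<gamma>) * ?s (cis \<delta>)) > 0"
  proof (cases "t = 0")
    case True then show ?thesis using pp by auto
  next
    case False
    then have "t * (?s (cis \<gamma>) * ?s (cis \<delta>)) > 0" using t(2) pp mult_pos_pos[of t] by simp
    moreover have "(1 - t) * (?s (cis \<gamma>))\<^sup>2 \<ge> 0" using t(3) by simp
    ultimately show ?thesis by linarith
  qed
  ultimately show False using 0 by simp
qed

text \<open>An edge is an unordered pair and a path has a direction; the choice operator picks one
  of the two directions, and nothing depends on which.\<close>

definition chord_drawing :: "('a \<Rightarrow> real) \<Rightarrow> 'a drawing" where
  "chord_drawing \<theta> = (\<lambda>v. cis (\<theta> v),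
     \<lambda>e. SOME g. \<exists>a b. e = {a, b} \<and> g = linepath (cis (\<theta> a)) (cis (\<theta> b)))"

lemma chord_drawing_curve:
  obtains "curve_of (chord_drawing \<theta>) {a, b} = linepath (cis (\<theta> a)) (cis (\<theta> b))"
  | "curve_of (chord_drawing \<theta>) {a, b} = linepath (cis (\<theta> b)) (cis (\<theta> a))"
proof -
  let ?P = "\<lambda>g. \<exists>a' b'. {a, b} = {a', b'} \<and> g = linepath (cis (\<theta> a')) (cis (\<theta> b'))"
  have "?P (linepath (cis (\<theta> a)) (cis (\<theta> b)))" by blast
  then have "\<exists>g. ?P g" by blast
  then have "?P (SOME g. ?P g)" by (rule someI_ex)
  then show thesis using that by (auto simp: chord_drawing_def doubleton_eq_iff)
qed

lemma chord_drawing_path_image: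
  "path_image (curve_of (chord_drawing \<theta>) {a, b}) = closed_segment (cis (\<theta> a)) (cis (\<theta> b))"
  by (rule chord_drawing_curve[of \<theta> a b]) (auto simp: closed_segment_commute)

text \<open>Strict convexity of the disk: an inner point of a chord is closer to the centre than its
  ends. Thus a chord passes through no third vertex.\<close>

lemma chord_unit:
  assumes "z \<in> closed_segment (cis \<alpha>) (cis \<beta>)" "norm z = 1"
  shows "z = cis \<alpha> \<or> z = cis \<beta>"
  using dist_decreases_open_segment[of z "cis \<alpha>" "cis \<beta>" 0] assms
  by (auto simp: open_segment_def)

locale vertex_angles =
  fixes B :: "'a graph" and \<theta> :: "'a \<Rightarrow> real"
  assumes simple: "simple_graph B" and inj: "inj_on \<theta> (verts B)"
    and range: "u \<in> verts B \<Longrightarrow> v \<in> verts B \<Longrightarrow> \<bar>\<theta> u - \<theta> v\<bar> < 2 * pi"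
begin

lemma edgeE:
  assumes "e \<in> edges B"
  obtains a b where "e = {a, b}" "a \<in> verts B" "b \<in> verts B" "a \<noteq> b" "\<theta> a \<noteq> \<theta> b"
proof -
  have "card e = 2" "e \<subseteq> verts B" using simple assms by (auto simp: simple_graph_def)
  then obtain x y where "e = {x, y}" "x \<noteq> y" "x \<in> verts B" "y \<in> verts B"
    by (auto simp: card_2_iff)
  then show thesis using that[of x y] inj by (auto simp: inj_on_def)
qed

lemma cis_inj:
  assumes "u \<in> verts B" "v \<in> verts B" "cis (\<theta> u) = cis (\<theta> v)"
  shows "u = v"
proof (rule ccontr)
  assume "u \<noteq> v"
  then have "\<theta> u - \<theta> v \<noteq> 0" using inj assms by (auto simp: inj_on_def)
  moreover have "cis (\<theta> u) - cis (\<theta> v) = 0" using assms by simp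
  ultimately show False
    unfolding cis_diff using sin_half_ne_0[OF range[OF assms(1,2)]] by simp
qed

lemma chords_meet:
  assumes "e \<in> edges B" "f \<in> edges B" "e \<noteq> f"
    "z \<in> path_image (curve_of (chord_drawing \<theta>) e)" "z \<in> path_image (curve_of (chord_drawing \<theta>) f)"
    "w \<in> path_image (curve_of (chord_drawing \<theta>) e)" "w \<in> path_image (curve_of (chord_drawing \<theta>) f)"
  shows "z = w"
proof -
  obtain a c where e: "e = {a, c}" "a \<in> verts B" "c \<in> verts B" "\<theta> a \<noteq> \<theta> c" using assms(1) by (rule edgeE)
  obtain b d where f: "f = {b, d}" "b \<in> verts B" "d \<in> verts B" "\<theta> b \<noteq> \<theta> d" using assms(2) by (rule edgeE)
  show ?thesis
  proof (rule chords_meet_once[OF _ e(4) f(4)])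
    show "{\<theta> a, \<theta> c} \<noteq> {\<theta> b, \<theta> d}"
      using assms(3) e f inj unfolding e(1) f(1) doubleton_eq_iff inj_on_def by metis
  qed (use assms e f range in \<open>auto simp: chord_drawing_path_image\<close>)
qed

lemma crossing_imp_crosses:
  assumes "e \<in> edges B" "f \<in> edges B" "e \<noteq> f" "crossing_points B (chord_drawing \<theta>) e f \<noteq> {}"
  shows "crosses \<theta> e f"
proof -
  obtain a c where e: "e = {a, c}" "a \<in> verts B" "c \<in> verts B" "a \<noteq> c" "\<theta> a \<noteq> \<theta> c" using assms(1) by (rule edgeE)
  obtain b d where f: "f = {b, d}" "b \<in> verts B" "d \<in> verts B" "b \<noteq> d" "\<theta> b \<noteq> \<theta> d" using assms(2) by (rule edgeE)
  obtain z where z: "z \<in> path_image (curve_of (chord_drawing \<theta>) e)" "z \<in> path_image (curve_of (chord_drawing \<theta>) f)"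
    and zv: "z \<notin> (\<lambda>v. cis (\<theta> v)) ` verts B"
    using assms(4) by (auto simp: crossing_points_def chord_drawing_def)
  \<comment> \<open>A common end would be the only common point of the two chords, but
    \<open>z\<close> is a common point that is not a vertex.\<close>
  have "e \<inter> f = {}"
  proof (rule ccontr)
    assume "e \<inter> f \<noteq> {}"
    then obtain v where v: "v \<in> e" "v \<in> f" by auto
    then have "cis (\<theta> v) \<in> path_image (curve_of (chord_drawing \<theta>) e)" "cis (\<theta> v) \<in> path_image (curve_of (chord_drawing \<theta>) f)"
      using e f by (auto simp: chord_drawing_path_image)
    then have "z = cis (\<theta> v)" using chords_meet[OF assms(1-3) z] by blast
    then show False using zv v e by auto
  qed
  then have "{\<theta> a, \<theta> c} \<inter> {\<theta> b, \<theta> d} = {}"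
    using e f inj by (auto simp: inj_on_def)
  then have "interleave (\<theta> a) (\<theta> c) (\<theta> b) (\<theta> d)"
    using chords_meet_imp_interleave[OF _ e(5) f(5)] z range e f by (auto simp: chord_drawing_path_image)
  then show ?thesis using e f by simp
qed

lemma chord_drawing_disk: "disk_drawing B (chord_drawing \<theta>)"
  unfolding disk_drawing_def
proof (intro conjI ballI impI)
  have pt: "point_of (chord_drawing \<theta>) v = cis (\<theta> v)" for v by (simp add: chord_drawing_def)
  show "inj_on (point_of (chord_drawing \<theta>)) (verts B)" using cis_inj by (auto simp: inj_on_def pt)
  show "point_of (chord_drawing \<theta>) ` verts B \<subseteq> sphere 0 1" by (auto simp: pt)
  fix e assume e: "e \<in> edges B"
  obtain a c where ac: "e = {a, c}" "a \<in> verts B" "c \<in> verts B" "a \<noteq> c" "\<theta> a \<noteq> \<theta> c" using e by (rule edgeE)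
  have ne: "cis (\<theta> a) \<noteq> cis (\<theta> c)" using cis_inj ac by blast
  show "arc (curve_of (chord_drawing \<theta>) e)"
    using ne unfolding ac(1) by (rule_tac chord_drawing_curve[of \<theta> a c]) (auto simp: arc_linepath)
  show "{pathstart (curve_of (chord_drawing \<theta>) e), pathfinish (curve_of (chord_drawing \<theta>) e)} = point_of (chord_drawing \<theta>) ` e"
    unfolding ac(1) by (rule_tac chord_drawing_curve[of \<theta> a c]) (auto simp: pt)
  show "path_image (curve_of (chord_drawing \<theta>) e) \<subseteq> cball 0 1"
    unfolding ac(1) chord_drawing_path_image by (rule closed_segment_subset) auto
  show "path_image (curve_of (chord_drawing \<theta>) e) \<inter> point_of (chord_drawing \<theta>) ` verts B = point_of (chord_drawing \<theta>) ` e"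
    unfolding ac(1) chord_drawing_path_image using ac chord_unit by (fastforce simp: pt)
  fix f assume f: "f \<in> edges B" "e \<noteq> f"
  let ?I = "path_image (curve_of (chord_drawing \<theta>) e) \<inter> path_image (curve_of (chord_drawing \<theta>) f)"
  have "\<forall>z\<in>?I. \<forall>w\<in>?I. z = w" using chords_meet[OF e f] by blast
  then obtain z where "?I \<subseteq> {z}" by blast
  then show "finite ?I" by (rule finite_subset) simp
qed

lemma chord_drawing_pseudo_outerplanar:
  assumes "one_crossing_order \<theta> B"
  shows "pseudo_outerplanar_drawing B (chord_drawing \<theta>)"
  unfolding pseudo_outerplanar_drawing_def
proof (intro conjI ballI chord_drawing_disk)
  fix e assume e: "e \<in> edges B"
  have "edges B \<subseteq> Pow (verts B)" using simple by (auto simp: simple_graph_def)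
  then have "finite (edges B)" using simple by (auto simp: simple_graph_def intro: finite_subset)
  then have fin: "finite {f \<in> edges B. f \<noteq> e \<and> crossing_points B (chord_drawing \<theta>) e f \<noteq> {}}" by simp
  show "card {f \<in> edges B. f \<noteq> e \<and> crossing_points B (chord_drawing \<theta>) e f \<noteq> {}} \<le> 1"
    unfolding One_nat_def card_le_Suc0_iff_eq[OF fin]
    using crossing_imp_crosses[OF e] assms e unfolding one_crossing_order_def by blast
qed

end

section \<open>Maximal orders\<close>

text \<open>The two conditions in \<open>maximal\<close> say that after adding \<open>ij\<close> each edge would still cross at most
  one other edge.\<close>

locale maximal_order =
  fixes n :: nat and E :: "nat \<Rightarrow> nat \<Rightarrow> bool"
  assumes sym: "E i j \<Longrightarrow> E j i"
    and bound: "E i j \<Longrightarrow> i < n"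
    and irrefl: "\<not> E i i"
    and one: "E i j \<Longrightarrow> E k l \<Longrightarrow> E k' l' \<Longrightarrow> interleave i j k l \<Longrightarrow> interleave i j k' l' \<Longrightarrow> {k, l} = {k', l'}"
    and maximal: "i < n \<Longrightarrow> j < n \<Longrightarrow> i \<noteq> j \<Longrightarrow>
       (\<And>k l k' l'. E k l \<Longrightarrow> E k' l' \<Longrightarrow> interleave i j k l \<Longrightarrow> interleave i j k' l' \<Longrightarrow> {k, l} = {k', l'}) \<Longrightarrow>
       (\<And>k l k' l'. E k l \<Longrightarrow> E k' l' \<Longrightarrow> interleave i j k l \<Longrightarrow> interleave k l k' l' \<Longrightarrow> False) \<Longrightarrow> E i j"
begin

text \<open>Meant for non-adjacent pairs too: if no edge crosses \<open>ij\<close>, both premises of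
  \<open>maximal\<close> hold vacuously and \<open>ij\<close> is an edge.\<close>

definition uncrossed :: "nat \<Rightarrow> nat \<Rightarrow> bool" where
  "uncrossed i j \<longleftrightarrow> (\<forall>k l. E k l \<longrightarrow> \<not> interleave i j k l)"

lemma uncrossedD: "uncrossed i j \<Longrightarrow> E k l \<Longrightarrow> \<not> interleave i j k l"
  by (simp add: uncrossed_def)

lemma uncrossed_edge: "i < n \<Longrightarrow> j < n \<Longrightarrow> i \<noteq> j \<Longrightarrow> uncrossed i j \<Longrightarrow> E i j"
  by (rule maximal) (auto simp: uncrossed_def)

lemma bound2: "E i j \<Longrightarrow> j < n"
  using bound sym by blast

lemma uncrossedI: "(\<And>k l. E k l \<Longrightarrow> k < l \<Longrightarrow> l < n \<Longrightarrow> interleave i j k l \<Longrightarrow> False) \<Longrightarrow> uncrossed i j"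
  unfolding uncrossed_def by (metis bound2 interleave_swap(2) irrefl nat_neq_iff sym)

lemma uncrossed_Suc: "uncrossed i (Suc i)"
  by (rule uncrossedI) (auto simp: interleave_less)

lemma uncrossed_ends: "uncrossed 0 (n - 1)"
  by (rule uncrossedI) (auto simp: interleave_less)

lemma path_edge: "Suc i < n \<Longrightarrow> E i (Suc i)"
  using uncrossed_edge uncrossed_Suc by simp

lemma ends_edge: "n \<ge> 2 \<Longrightarrow> E 0 (n - 1)"
  using uncrossed_edge uncrossed_ends by simp

lemma one_cross:
  assumes "E a c" "E b d" "a < b" "b < c" "c < d" "E k l" "k < l"
  shows "a < k \<and> k < c \<and> c < l \<or> k < a \<and> a < l \<and> l < c \<Longrightarrow> k = b \<and> l = d"
    and "b < k \<and> k < d \<and> d < l \<or> k < b \<and> b < l \<and> l < d \<Longrightarrow> k = a \<and> l = c"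
  using one[of a c b d k l] one[of b d a c k l] assms
  by (auto simp: doubleton_eq_iff interleave_less)

text \<open>An edge crossing a side of the quadrilateral \<open>a\<close>, \<open>b\<close>,
  \<open>c\<close>, \<open>d\<close> also crosses the diagonal \<open>ac\<close> or
  \<open>bd\<close>. That diagonal is already crossed by the other one, so the edge would be a
  diagonal; but each diagonal shares an end with every side.\<close>

lemma crossing_sides:
  assumes "E a c" "E b d" "a < b" "b < c" "c < d"
  shows "uncrossed a b" "uncrossed b c" "uncrossed c d" "uncrossed a d" "E a b" "E b c" "E c d" "E a d"
proof -
  have *: "\<not> interleave a b k l" "\<not> interleave b c k l" "\<not> interleave c d k l" "\<not> interleave a d k l"
    if kl: "E k l" "k < l" for k l
  proof -
    have "a < d" using assms by simp
    note il = interleave_less[OF assms(3) that(2)] interleave_less[OF assms(4) that(2)]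
      interleave_less[OF assms(5) that(2)] interleave_less[OF \<open>a < d\<close> that(2)]
    show "\<not> interleave a b k l" "\<not> interleave b c k l" "\<not> interleave c d k l" "\<not> interleave a d k l"
      unfolding il
    proof (goal_cases)
      consider "k = b \<and> l = d \<or> k = a \<and> l = c"
        | "\<not> (a < k \<and> k < c \<and> c < l)" "\<not> (k < a \<and> a < l \<and> l < c)"
          "\<not> (b < k \<and> k < d \<and> d < l)" "\<not> (k < b \<and> b < l \<and> l < d)"
        using one_cross[OF assms kl] by blast
      note cs = this
      { case 1 from cs show ?case using assms(3-5) that(2) by cases (fastforce, linarith) }
      { case 2 from cs show ?case using assms(3-5) that(2) by cases (fastforce, linarith) }
      { case 3 from cs show ?case using assms(3-5) that(2) by cases (fastforce, linarith) }
      { case 4 from cs show ?case using assms(3-5) that(2) by cases (fastforce, linarith) }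
    qed
  qed
  show "uncrossed a b" "uncrossed b c" "uncrossed c d" "uncrossed a d" using * by (auto intro: uncrossedI)
  then show "E a b" "E b c" "E c d" "E a d"
    using assms bound[OF assms(1)] bound[OF assms(2)] bound2[OF assms(1)] bound2[OF assms(2)]
    by (auto intro!: uncrossed_edge)
qed

text \<open>\<open>xy\<close> is chosen with \<open>y - x\<close> least among uncrossed edges that
  skip a vertex. Any other such edge inside \<open>xy\<close> is crossed, and the sides of the
  resulting quadrilateral are uncrossed, so minimality forces a K_4 on consecutive vertices. Without
  inner edges, \<open>x\<close> and \<open>x + 2\<close> are joined by maximality, and this can only
  be \<open>xy\<close>.\<close>

lemma leaf_exists:
  assumes "n \<ge> 3"
  obtains x y where "E x y" "uncrossed x y" "y < n"
    "y = x + 2 \<or> y = x + 3 \<and> E x (x + 2) \<and> E (x + 1) (x + 3)"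
proof -
  define P where "P k \<longleftrightarrow> k \<ge> 2 \<and> (\<exists>x. E x (x + k) \<and> uncrossed x (x + k))" for k
  have "P (n - 1)" using ends_edge uncrossed_ends assms by (auto simp: P_def intro!: exI[of _ 0])
  then have Pk: "P (LEAST k. P k)" by (rule LeastI)
  define k where "k = (LEAST k. P k)"
  have least: "k \<le> j" if "P j" for j using that unfolding k_def by (rule Least_le)
  from Pk obtain x where x: "k \<ge> 2" "E x (x + k)" "uncrossed x (x + k)" unfolding k_def P_def by blast
  define y where "y = x + k"
  have least': "x + k = y" "y - x \<le> t - s" if "uncrossed s t" "E s t" "s + 2 \<le> t" for s t
  proof -
    have "s + (t - s) = t" using that(3) by simp
    then have "P (t - s)" using that unfolding P_def by (intro conjI exI[of _ s]) auto
    then show "x + k = y" "y - x \<le> t - s" using least by (auto simp: y_def)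
  qed
  have xy: "E x y" "uncrossed x y" "x + 2 \<le> y" "y < n" using x bound2 by (auto simp: y_def)
  show thesis
  proof (cases "\<exists>s t. E s t \<and> x \<le> s \<and> s + 2 \<le> t \<and> t \<le> y \<and> (s, t) \<noteq> (x, y)")
    case True
    then obtain s t where st: "E s t" "x \<le> s" "s + 2 \<le> t" "t \<le> y" "(s, t) \<noteq> (x, y)" by blast
    then have "\<not> uncrossed s t" using least'[of s t] by auto
    then obtain s' t' where s': "E s' t'" "s' < t'" "interleave s t s' t'" using uncrossedI by blast
    have in': "x \<le> s'" "t' \<le> y"
      using uncrossedD[OF xy(2) s'(1)] s'(2,3) st by (auto simp: interleave_less)
    obtain a b c d where q: "E a c" "E b d" "a < b" "b < c" "c < d" "x \<le> a" "d \<le> y"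
    proof -
      from s' st have "s < s' \<and> s' < t \<and> t < t' \<or> s' < s \<and> s < t' \<and> t' < t"
        by (simp add: interleave_less)
      then show thesis using that[of s t s' t'] that[of s' t' s t] s' st in' by auto
    qed
    note cs = crossing_sides[OF q(1-5)]
    \<comment> \<open>The sides are uncrossed edges, so minimality leaves no vertex under
      \<open>ab\<close>, \<open>bc\<close> or \<open>cd\<close> and lets \<open>ad\<close> be no
      shorter than \<open>xy\<close>.\<close>
    have "b = Suc a" using least'[OF cs(1,5)] q by (cases "a + 2 \<le> b") auto
    moreover have "c = Suc b" using least'[OF cs(2,6)] q by (cases "b + 2 \<le> c") auto
    moreover have "d = Suc c" using least'[OF cs(3,7)] q by (cases "c + 2 \<le> d") auto
    moreover have "a = x" "d = y" using least'[OF cs(4,8)] q by auto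
    ultimately have "y = x + 3" "E x (x + 2)" "E (x + 1) (x + 3)" using q(1,2) by (auto simp: numeral_eq_Suc)
    then show thesis using that[of x y] xy by blast
  next
    case False
    show thesis
    proof (cases "y = x + 2")
      case True then show thesis using that xy by blast
    next
      case ne: False
      \<comment> \<open>An edge crossing this pair stays inside \<open>xy\<close>, which is
        uncrossed, and skips a vertex; no such edge is left.\<close>
      have "uncrossed x (x + 2)"
      proof (rule uncrossedI)
        fix k l assume kl: "E k l" "k < l" "interleave x (x + 2) k l"
        then have "k \<noteq> x" "l \<noteq> x + 2" "x \<le> k" "l \<le> y" "(k, l) \<noteq> (x, y)" "k + 2 \<le> l"
          using uncrossedD[OF xy(2) kl(1)] xy ne by (auto simp: interleave_less)
        then show False using False kl(1) by blast
      qed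
      then have "E x (x + 2)" using uncrossed_edge xy ne by auto
      then show thesis using False xy ne by fastforce
    qed
  qed
qed

end

text \<open>The case where \<open>u\<close> comes first. If \<open>uv\<close> crosses no crossed edge, then, \<open>v\<close> being the first such
  non-neighbour, all edges crossing \<open>uv\<close> end in the same vertex \<open>s\<close> between \<open>u\<close> and \<open>v\<close>; by maximality
  there are at least two, and \<open>u\<close> can be joined to the last but one neighbour of \<open>s\<close>.\<close>

lemma nonadjacent_crosses_crossed_first:
  fixes p :: "nat \<Rightarrow> nat" and E :: "nat \<Rightarrow> nat \<Rightarrow> bool"
  assumes sym: "\<And>i j. E i j \<Longrightarrow> E j i"
    and bound: "\<And>i j. E i j \<Longrightarrow> i < n"
    and maximal: "\<And>i j. i < n \<Longrightarrow> j < n \<Longrightarrow> i \<noteq> j \<Longrightarrow>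
       (\<And>k l k' l'. E k l \<Longrightarrow> E k' l' \<Longrightarrow> interleave (p i) (p j) (p k) (p l) \<Longrightarrow>
          interleave (p i) (p j) (p k') (p l') \<Longrightarrow> {k, l} = {k', l'}) \<Longrightarrow>
       (\<And>k l k' l'. E k l \<Longrightarrow> E k' l' \<Longrightarrow> interleave (p i) (p j) (p k) (p l) \<Longrightarrow>
          interleave (p k) (p l) (p k') (p l') \<Longrightarrow> False) \<Longrightarrow> E i j"
    and inj: "inj_on p {..<n}"
    and u: "u < n" "\<And>i. i < n \<Longrightarrow> i \<noteq> u \<Longrightarrow> p u < p i"
    and v: "v < n" "v \<noteq> u" "\<not> E u v"
  shows "\<exists>k l k' l'. E k l \<and> E k' l' \<and> interleave (p u) (p v) (p k) (p l) \<and> interleave (p k) (p l) (p k') (p l')"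
proof (rule ccontr)
  define bad where "bad v \<longleftrightarrow> v < n \<and> v \<noteq> u \<and> \<not> E u v \<and>
    \<not> (\<exists>k l k' l'. E k l \<and> E k' l' \<and> interleave (p u) (p v) (p k) (p l) \<and> interleave (p k) (p l) (p k') (p l'))" for v
  assume "\<not> ?thesis"
  with v have "bad v" unfolding bad_def by blast
  then have "\<exists>v. bad v \<and> (\<forall>w. bad w \<longrightarrow> p v \<le> p w)"
    using ex_has_least_nat[of bad v p] by blast
  then obtain v where v: "bad v" and vmin: "\<And>w. bad w \<Longrightarrow> p v \<le> p w" by blast
  have vn: "v < n" "v \<noteq> u" "\<not> E u v" using v by (auto simp: bad_def)
  have unc: "\<not> interleave (p k) (p l) (p k') (p l')"
    if "E k l" "E k' l'" "interleave (p u) (p v) (p k) (p l)" for k l k' l'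
    using v that unfolding bad_def by blast
  have puv: "p u < p v" using u vn by blast
  have b2: "j < n" if "E i j" for i j using bound sym that by blast
  have peq: "i = j" if "p i = p j" "i < n" "j < n" for i j using inj that by (auto simp: inj_on_def)
  define C where "C s t \<longleftrightarrow> E s t \<and> p u < p s \<and> p s < p v \<and> p v < p t" for s t
  have ule: "p u \<le> p i" if "i < n" for i using u(2)[of i] that by (cases "i = u") auto
  have ordered: "\<exists>q r. E q r \<and> {k, l} = {q, r} \<and> p u < p q \<and> p q < p x \<and> p x < p r"
    if "E k l" "interleave (p u) (p x) (p k) (p l)" "p u < p x" for k l x
    using that sym[OF that(1)] ule[OF bound[OF that(1)]] ule[OF b2[OF that(1)]]
    by (auto simp: interleave_first)
  have Cil: "interleave (p u) (p v) (p s) (p t)" if "C s t" for s t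
    using that by (simp add: C_def interleave_less)
  \<comment> \<open>As \<open>s\<close> precedes \<open>v\<close>, it is not bad. If
    \<open>us\<close> were missing, a crossed edge \<open>qr\<close> would cross it; this edge
    cannot cross \<open>uv\<close>, so \<open>r\<close> is not beyond \<open>v\<close> and
    \<open>qr\<close> crosses \<open>st\<close>. But \<open>st\<close> crosses \<open>uv\<close> and
    must be uncrossed.\<close>
  have usE: "E u s" if C: "C s t" for s t
  proof (rule ccontr)
    assume "\<not> E u s"
    moreover have "\<not> bad s" using vmin[of s] C by (auto simp: C_def)
    ultimately obtain k l k' l' where k: "E k l" "E k' l'" "interleave (p u) (p s) (p k) (p l)"
      "interleave (p k) (p l) (p k') (p l')"
      using C bound unfolding bad_def C_def by blast
    have "p u < p s" using C by (simp add: C_def)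
    obtain q r where qr: "E q r" "{k, l} = {q, r}" "p u < p q" "p q < p s" "p s < p r"
      using ordered[OF k(1,3) \<open>p u < p s\<close>] by blast
    have "interleave (p q) (p r) (p k') (p l')" using k(4) qr(2)
      by (auto simp: doubleton_eq_iff interleave_swap)
    then have "\<not> interleave (p u) (p v) (p q) (p r)" using unc k(2) qr(1) by blast
    moreover have "\<not> interleave (p s) (p t) (p q) (p r)" using unc[OF _ qr(1) Cil[OF C]] C by (simp add: C_def)
    ultimately show False using qr C by (simp add: interleave_less C_def)
  qed
  \<comment> \<open>For \<open>s\<close> before \<open>s'\<close> the edge \<open>us'\<close>,
    present by \<open>usE\<close>, would cross \<open>st\<close>.\<close>
  have same: "s = s'" if C: "C s t" "C s' t'" for s t s' t'
  proof (rule ccontr)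
    have *: False if "C s t" "C s' t'" "p s < p s'" for s t s' t'
      using unc[OF _ usE[OF that(2)] Cil[OF that(1)]] that by (simp add: C_def interleave_less)
    assume "s \<noteq> s'"
    then have "p s \<noteq> p s'" using peq bound C unfolding C_def by blast
    then show False using * C by (metis nat_neq_iff)
  qed
  obtain s t0 t1 where st: "C s t0" "C s t1" "t0 \<noteq> t1"
  proof -
    from vn have "\<exists>k l k' l'. E k l \<and> E k' l' \<and> interleave (p u) (p v) (p k) (p l) \<and>
       interleave (p u) (p v) (p k') (p l') \<and> {k, l} \<noteq> {k', l'}"
      using maximal[of u v] u(1) unc by blast
    then obtain k l k' l' where k: "E k l" "E k' l'" "interleave (p u) (p v) (p k) (p l)"
       "interleave (p u) (p v) (p k') (p l')" "{k, l} \<noteq> {k', l'}" by blast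
    obtain a b where ab: "C a b" "{k, l} = {a, b}" using ordered[OF k(1,3) puv] by (auto simp: C_def)
    obtain c d where cd: "C c d" "{k', l'} = {c, d}" using ordered[OF k(2,4) puv] by (auto simp: C_def)
    have "a = c" using same ab cd by blast
    then show thesis using that[of a b d] ab cd k(5) by auto
  qed
  \<comment> \<open>Here \<open>t\<close> will be the last and \<open>t'\<close> the last but one
    neighbour of \<open>s\<close> beyond \<open>v\<close>.\<close>
  define T where "T = {t. C s t}"
  have fin: "finite T" by (rule finite_subset[of _ "{..<n}"]) (auto simp: T_def C_def b2)
  have greatest: "\<exists>t\<in>S. \<forall>x\<in>S. p x \<le> p t" if "finite S" "S \<noteq> {}" for S
    using Max_in[of "p ` S"] Max_ge[of "p ` S"] that by fastforce
  obtain t where t: "t \<in> T" "\<And>x. x \<in> T \<Longrightarrow> p x \<le> p t"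
    using greatest[OF fin] st by (auto simp: T_def)
  have "T - {t} \<noteq> {}" using st by (auto simp: T_def)
  then obtain t' where t': "t' \<in> T - {t}" "\<And>x. x \<in> T - {t} \<Longrightarrow> p x \<le> p t'"
    using greatest[of "T - {t}"] fin by auto
  have C: "C s t" "C s t'" "t \<noteq> t'" using t t' by (auto simp: T_def)
  have sn: "s < n" "t < n" "t' < n" using C bound b2 by (auto simp: C_def)
  have tt: "p t' < p t"
    using t(2)[of t'] t' peq[of t t'] C(3) sn by (auto simp: order_less_le)
  have ut': "p u < p t'" using C by (simp add: C_def)
  \<comment> \<open>An edge crossing \<open>ut'\<close> cannot start after \<open>s\<close>, or it
    would cross \<open>st'\<close>. So it crosses \<open>uv\<close> as well and therefore starts in
    \<open>s\<close>; beyond \<open>t'\<close> only \<open>t\<close> remains for its other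
    end.\<close>
  have only: "{k, l} = {s, t}" if kl: "E k l" "interleave (p u) (p t') (p k) (p l)" for k l
  proof -
    obtain q r where qr: "E q r" "{k, l} = {q, r}" "p u < p q" "p q < p t'" "p t' < p r"
      using ordered[OF kl ut'] by blast
    have "\<not> interleave (p s) (p t') (p q) (p r)" using unc[OF _ qr(1) Cil[OF C(2)]] C by (simp add: C_def)
    then have "p q \<le> p s" using qr C by (simp add: C_def interleave_less)
    then have "C q r" using qr C by (simp add: C_def)
    then have "q = s" "r \<in> T" using same C by (auto simp: T_def)
    then have "r = t" using t'(2)[of r] qr by force
    with \<open>q = s\<close> qr show ?thesis by simp
  qed
  \<comment> \<open>Only \<open>st\<close> crosses \<open>ut'\<close>, and nothing crosses
    \<open>st\<close>, so maximality makes \<open>ut'\<close> an edge. It then crosses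
    \<open>st\<close>, a contradiction.\<close>
  have "E u t'"
  proof (rule maximal)
    show "u \<noteq> t'" using ut' by auto
    fix k l k' l' assume k: "E k l" "E k' l'" "interleave (p u) (p t') (p k) (p l)"
    { assume "interleave (p u) (p t') (p k') (p l')"
      then show "{k, l} = {k', l'}" using only k by blast }
    { assume "interleave (p k) (p l) (p k') (p l')"
      then have "interleave (p s) (p t) (p k') (p l')" using only[OF k(1,3)]
        by (auto simp: doubleton_eq_iff interleave_swap)
      then show False using unc[OF _ k(2) Cil[OF C(1)]] C by (simp add: C_def) }
  qed (use u sn in auto)
  then have "\<not> interleave (p s) (p t) (p u) (p t')" using unc[OF _ _ Cil[OF C(1)]] C by (simp add: C_def)
  then show False using C tt by (simp add: C_def interleave_less)
qed

section \<open>Rigidity of saturated orders\<close>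

text \<open>Interleaving does not depend on where the cyclic order is opened, so \<open>u\<close>
  may be taken to come first.\<close>

lemma (in maximal_order) nonadjacent_crosses_crossed:
  assumes "u < n" "v < n" "u \<noteq> v" "\<not> E u v"
  shows "\<exists>k l k' l'. E k l \<and> E k' l' \<and> interleave u v k l \<and> interleave k l k' l'"
proof -
  define p where "p i = (if i < u then i + n else i)" for i
  have p: "interleave (p i) (p j) (p k) (p l) \<longleftrightarrow> interleave i j k l" if "i < n" "j < n" "k < n" "l < n" for i j k l
    by (rule interleave_rotate[where P = "\<lambda>i. i < u"]) (use that in \<open>auto simp: p_def\<close>)
  have "\<exists>k l k' l'. E k l \<and> E k' l' \<and> interleave (p u) (p v) (p k) (p l) \<and> interleave (p k) (p l) (p k') (p l')"
  proof (rule nonadjacent_crosses_crossed_first[of E n p])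
    show "inj_on p {..<n}" by (auto simp: inj_on_def p_def)
    show "p u < p i" if "i < n" "i \<noteq> u" for i using that assms by (auto simp: p_def)
    fix i j assume ij: "i < n" "j < n" "i \<noteq> j" and
      1: "\<And>k l k' l'. E k l \<Longrightarrow> E k' l' \<Longrightarrow> interleave (p i) (p j) (p k) (p l) \<Longrightarrow>
          interleave (p i) (p j) (p k') (p l') \<Longrightarrow> {k, l} = {k', l'}" and
      2: "\<And>k l k' l'. E k l \<Longrightarrow> E k' l' \<Longrightarrow> interleave (p i) (p j) (p k) (p l) \<Longrightarrow>
          interleave (p k) (p l) (p k') (p l') \<Longrightarrow> False"
    from ij show "E i j"
    proof (rule maximal)
      show "{k, l} = {k', l'}" if "E k l" "E k' l'" "interleave i j k l" "interleave i j k' l'" for k l k' l'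
        using 1[OF that(1,2)] that p ij bound bound2 by simp
      show False if "E k l" "E k' l'" "interleave i j k l" "interleave k l k' l'" for k l k' l'
        using 2[OF that(1,2)] that p ij bound[OF that(1)] bound2[OF that(1)] bound[OF that(2)] bound2[OF that(2)] by simp
    qed
  qed (use assms sym bound in auto)
  then show ?thesis using p assms bound bound2 by (metis (no_types, lifting))
qed

text \<open>A complete graph on four vertices has, in any order, one crossing pair of edges \<open>g\<close>, \<open>h\<close>. No other
  edge crosses \<open>g\<close> or \<open>h\<close>, so a path outside the four vertices leads only to one end of \<open>g\<close> and
  one end of \<open>h\<close>.\<close>

definition linked :: "('v \<Rightarrow> 'v \<Rightarrow> bool) \<Rightarrow> 'v set \<Rightarrow> 'v \<Rightarrow> 'v \<Rightarrow> bool" where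
  "linked E Q w x \<longleftrightarrow> (\<exists>s. (w, s) \<in> {(s, t). E s t \<and> s \<notin> Q \<and> t \<notin> Q}\<^sup>* \<and> E s x)"

lemma linked_edge: "E w x \<Longrightarrow> linked E Q w x"
  unfolding linked_def by blast

lemma linked_step: "E w s \<Longrightarrow> w \<notin> Q \<Longrightarrow> s \<notin> Q \<Longrightarrow> linked E Q s x \<Longrightarrow> linked E Q w x"
  unfolding linked_def by (auto intro: converse_rtrancl_into_rtrancl)

lemma linked_K4:
  fixes \<sigma> :: "'v \<Rightarrow> 'b::linorder"
  assumes sym: "\<And>i j. E i j \<Longrightarrow> E j i" and V: "\<And>i j. E i j \<Longrightarrow> i \<in> V" and irr: "\<And>i. \<not> E i i"
    and one: "\<And>i j k l k' l'. E i j \<Longrightarrow> E k l \<Longrightarrow> E k' l' \<Longrightarrow> interleave (\<sigma> i) (\<sigma> j) (\<sigma> k) (\<sigma> l) \<Longrightarrow>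
       interleave (\<sigma> i) (\<sigma> j) (\<sigma> k') (\<sigma> l') \<Longrightarrow> {k, l} = {k', l'}"
    and inj: "inj_on \<sigma> V"
    and K4: "E a b" "E a c" "E a d" "E b c" "E b d" "E c d"
    and w: "w \<notin> {a, b, c, d}"
    and xyz: "{x, y, z} \<subseteq> {a, b, c, d}" "x \<noteq> y" "y \<noteq> z" "x \<noteq> z"
    and L: "linked E {a, b, c, d} w x" "linked E {a, b, c, d} w y" "linked E {a, b, c, d} w z"
  shows False
proof -
  let ?Q = "{a, b, c, d}"
  have QV: "a \<in> V" "b \<in> V" "c \<in> V" "d \<in> V" using K4 V sym by blast+
  have \<sigma>: "\<sigma> i = \<sigma> j \<longleftrightarrow> i = j" if "i \<in> V" "j \<in> V" for i j using inj that by (auto simp: inj_on_def)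
  have "a \<noteq> b" "a \<noteq> c" "a \<noteq> d" "b \<noteq> c" "b \<noteq> d" "c \<noteq> d" using K4 irr by auto
  then have "interleave (\<sigma> a) (\<sigma> b) (\<sigma> c) (\<sigma> d) \<or> interleave (\<sigma> a) (\<sigma> c) (\<sigma> b) (\<sigma> d) \<or>
      interleave (\<sigma> a) (\<sigma> d) (\<sigma> b) (\<sigma> c)"
    by (intro interleave_pairing) (simp_all add: \<sigma> QV)
  then obtain g1 g2 h1 h2 where gh: "interleave (\<sigma> g1) (\<sigma> g2) (\<sigma> h1) (\<sigma> h2)" "E g1 g2" "E h1 h2"
    "?Q = {g1, g2, h1, h2}"
    using K4 by (elim disjE) (metis insert_commute)+
  have *: False
    if gh: "interleave (\<sigma> g1) (\<sigma> g2) (\<sigma> h1) (\<sigma> h2)" "E g1 g2" "E h1 h2" "?Q = {g1, g2, h1, h2}"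
      and l: "linked E ?Q w g1" "linked E ?Q w g2" for g1 g2 h1 h2
  proof -
    \<comment> \<open>\<open>sd\<close> tells the sides of the chord \<open>h1 h2\<close> apart. An
      edge from outside the K_4 that changes sides while avoiding \<open>h1\<close> and
      \<open>h2\<close> would be a second edge crossing \<open>h1 h2\<close>, besides
      \<open>g1 g2\<close>.\<close>
    define sd where "sd v \<longleftrightarrow> (\<sigma> h1 < \<sigma> v) \<noteq> (\<sigma> h2 < \<sigma> v)" for v
    have hV: "h1 \<in> V" "h2 \<in> V" using gh V sym by blast+
    have gne: "g1 \<notin> {h1, h2}" "g2 \<notin> {h1, h2}" using gh(1) by (auto dest: interleave_distinct)
    have edge: "sd s = sd t" if "E s t" "s \<notin> ?Q" "t \<notin> {h1, h2}" for s t
    proof (rule ccontr)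
      assume ne: "sd s \<noteq> sd t"
      have "s \<in> V" "t \<in> V" using that V sym by blast+
      then have "interleave (\<sigma> h1) (\<sigma> h2) (\<sigma> s) (\<sigma> t)"
      proof -
        have "s \<noteq> h1" "s \<noteq> h2" "t \<noteq> h1" "t \<noteq> h2" using that gh(4) by auto
        then have d: "\<sigma> h1 \<noteq> \<sigma> s" "\<sigma> h2 \<noteq> \<sigma> s" "\<sigma> h1 \<noteq> \<sigma> t" "\<sigma> h2 \<noteq> \<sigma> t"
          using \<sigma> hV \<open>s \<in> V\<close> \<open>t \<in> V\<close> by metis+
        show ?thesis using ne d unfolding sd_def interleave_xor by blast
      qed
      moreover have "interleave (\<sigma> h1) (\<sigma> h2) (\<sigma> g1) (\<sigma> g2)" using gh(1) interleave_sym by blast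
      ultimately have "{s, t} = {g1, g2}" using one gh that by blast
      then show False using that gh(4) by auto
    qed
    have reach: "sd w = sd s \<and> s \<notin> ?Q" if "(w, s) \<in> {(s, t). E s t \<and> s \<notin> ?Q \<and> t \<notin> ?Q}\<^sup>*" for s
      using that
    proof (induction rule: rtrancl_induct)
      case base then show ?case using w by simp
    next
      case (step s t)
      then have "sd s = sd t" using gh(4) by (intro edge) auto
      then show ?case using step by auto
    qed
    have "sd w = sd v" if "linked E ?Q w v" "v \<notin> {h1, h2}" for v
      using that reach edge unfolding linked_def by blast
    then have "sd g1 = sd g2" using l gne by metis
    moreover have "interleave (\<sigma> h1) (\<sigma> h2) (\<sigma> g1) (\<sigma> g2)" using gh(1) interleave_sym by blast
    ultimately show False by (auto simp: interleave_xor sd_def)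
  qed
  \<comment> \<open>Pigeonhole: three of the four vertices include both ends of one of the two
    crossing edges.\<close>
  have "linked E ?Q w g1 \<and> linked E ?Q w g2 \<or> linked E ?Q w h1 \<and> linked E ?Q w h2"
  proof -
    have "{x, y, z} \<subseteq> {g1, g2, h1, h2}" using xyz(1) gh(4) by simp
    then show ?thesis using L xyz(2-4) by auto
  qed
  then show False
  proof
    assume "linked E ?Q w g1 \<and> linked E ?Q w g2"
    then show False using *[OF gh] by blast
  next
    assume "linked E ?Q w h1 \<and> linked E ?Q w h2"
    moreover have "interleave (\<sigma> h1) (\<sigma> h2) (\<sigma> g1) (\<sigma> g2)" using gh(1) interleave_sym by blast
    moreover have "?Q = {h1, h2, g1, g2}" using gh(4) by auto
    ultimately show False using *[of h1 h2 g1 g2] gh by blast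
  qed
qed

text \<open>The consequences of maximality that survive the removal of the triangle or \<open>K\<^sub>4\<close> at the end.\<close>

locale saturated_order =
  fixes n :: nat and E :: "nat \<Rightarrow> nat \<Rightarrow> bool"
  assumes sym: "E i j \<Longrightarrow> E j i"
    and bound: "E i j \<Longrightarrow> i < n"
    and irrefl: "\<not> E i i"
    and one: "E i j \<Longrightarrow> E k l \<Longrightarrow> E k' l' \<Longrightarrow> interleave i j k l \<Longrightarrow> interleave i j k' l' \<Longrightarrow> {k, l} = {k', l'}"
    and path_edge: "Suc i < n \<Longrightarrow> E i (Suc i)"
    and ends_edge: "n \<ge> 2 \<Longrightarrow> E 0 (n - 1)"
    and sides: "E a c \<Longrightarrow> E b d \<Longrightarrow> a < b \<Longrightarrow> b < c \<Longrightarrow> c < d \<Longrightarrow> E a b \<and> E b c \<and> E c d \<and> E a d"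
    and separated: "u < n \<Longrightarrow> v < n \<Longrightarrow> u \<noteq> v \<Longrightarrow> \<not> E u v \<Longrightarrow>
       \<exists>k l k' l'. E k l \<and> E k' l' \<and> interleave u v k l \<and> interleave k l k' l'"

sublocale maximal_order \<subseteq> saturated_order
proof
  show "E i j \<Longrightarrow> E j i" for i j by (rule sym)
  show "E i j \<Longrightarrow> i < n" for i j by (rule bound)
  show "\<not> E i i" for i by (rule irrefl)
  show "E i j \<Longrightarrow> E k l \<Longrightarrow> E k' l' \<Longrightarrow> interleave i j k l \<Longrightarrow> interleave i j k' l' \<Longrightarrow> {k, l} = {k', l'}"
    for i j k l k' l' by (rule one[of i j k l k' l'])
  show "Suc i < n \<Longrightarrow> E i (Suc i)" for i by (rule path_edge)
  show "n \<ge> 2 \<Longrightarrow> E 0 (n - 1)" by (rule ends_edge)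
  show "E a c \<Longrightarrow> E b d \<Longrightarrow> a < b \<Longrightarrow> b < c \<Longrightarrow> c < d \<Longrightarrow> E a b \<and> E b c \<and> E c d \<and> E a d" for a b c d
    by (intro conjI crossing_sides(5-8)[of a c b d])
  show "u < n \<Longrightarrow> v < n \<Longrightarrow> u \<noteq> v \<Longrightarrow> \<not> E u v \<Longrightarrow>
       \<exists>k l k' l'. E k l \<and> E k' l' \<and> interleave u v k l \<and> interleave k l k' l'" for u v
    by (rule nonadjacent_crosses_crossed[of u v])
qed

context saturated_order begin

lemma bound': "E i j \<Longrightarrow> j < n"
  using bound sym by blast

lemma ordered_crossing:
  assumes "E k l" "E k' l'" "interleave k l k' l'"
  obtains (H) a b c d where "E a c" "E b d" "a < b" "b < c" "c < d"
    "{k, l} = {a, c} \<and> {k', l'} = {b, d} \<or> {k, l} = {b, d} \<and> {k', l'} = {a, c}"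
proof -
  have *: thesis if ij: "E i j" "E i' j'" "i < j" "i' < j'" "{k, l} = {i, j}" "{k', l'} = {i', j'}" for i j i' j'
  proof -
    have "interleave i j i' j'" using assms(3) ij(5,6)
      by (auto simp: doubleton_eq_iff interleave_swap)
    then consider "i < i'" "i' < j" "j < j'" | "i' < i" "i < j'" "j' < j"
      using ij(3,4) by (auto simp: interleave_less)
    then show thesis
    proof cases
      case 1 then show thesis by (intro H[of i j i' j']) (use ij in auto)
    next
      case 2 then show thesis by (intro H[of i' j' i j]) (use ij in auto)
    qed
  qed
  have "k \<noteq> l" "k' \<noteq> l'" using assms irrefl by auto
  then consider "k < l" "k' < l'" | "l < k" "k' < l'" | "k < l" "l' < k'" | "l < k" "l' < k'"
    by linarith
  then show thesis
  proof cases
    case 1 then show thesis by (intro *[of k l k' l'] assms) auto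
  next
    case 2 then show thesis by (intro *[of l k k' l'] assms sym[OF assms(1)]) auto
  next
    case 3 then show thesis by (intro *[of k l l' k'] assms sym[OF assms(2)]) auto
  next
    case 4 then show thesis by (intro *[of l k l' k'] assms sym[OF assms(1)] sym[OF assms(2)]) auto
  qed
qed

end

section \<open>Links along the boundary cycle\<close>

context saturated_order begin

lemma linked_down:
  assumes "x < w" "w < n" "\<And>i. x < i \<Longrightarrow> i \<le> w \<Longrightarrow> i \<notin> Q"
  shows "linked E Q w x"
  using assms
proof (induction w)
  case (Suc w)
  have e: "E (Suc w) w" using sym path_edge Suc.prems(2) by blast
  show ?case
  proof (cases "x = w")
    case True then show ?thesis using e by (simp add: linked_edge)
  next
    case False
    then show ?thesis using Suc e by (intro linked_step[of E "Suc w" w]) auto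
  qed
qed simp

lemma linked_up:
  assumes "w < x" "x < n" "\<And>i. w \<le> i \<Longrightarrow> i < x \<Longrightarrow> i \<notin> Q"
  shows "linked E Q w x"
  using assms(1,3)
proof (induction "x - w" arbitrary: w)
  case (Suc k)
  have e: "E w (Suc w)" using path_edge Suc.prems(1) assms(2) by simp
  show ?case
  proof (cases "x = Suc w")
    case True then show ?thesis using e by (simp add: linked_edge)
  next
    case False
    then have "linked E Q (Suc w) x" using Suc.hyps(2) Suc.prems by (intro Suc.hyps(1)) auto
    then show ?thesis using Suc.prems e False by (intro linked_step[of E w "Suc w"]) auto
  qed
qed simp

text \<open>Follows the boundary cycle upwards past its closing edge between \<open>n - 1\<close>
  and \<open>0\<close>; the premises keep \<open>Q\<close> off both pieces of the walk before its
  end \<open>a\<close>.\<close>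

lemma linked_wrap_up:
  assumes "a < w" "w < n" "\<And>i. w \<le> i \<Longrightarrow> i < n \<Longrightarrow> i \<notin> Q" "\<And>i. i < a \<Longrightarrow> i \<notin> Q"
  shows "linked E Q w a"
  using assms(1-3)
proof (induction "n - 1 - w" arbitrary: w)
  case 0
  then have w: "w = n - 1" by simp
  then have e: "E w 0" using sym[OF ends_edge] 0 by auto
  show ?case
  proof (cases "a = 0")
    case False
    then have "linked E Q 0 a" using 0 assms(4) by (intro linked_up) auto
    then show ?thesis using e 0 assms(4) False by (intro linked_step[of E w 0]) auto
  qed (use e in \<open>simp add: linked_edge\<close>)
next
  case (Suc k)
  then have e: "E w (Suc w)" using path_edge by simp
  have "linked E Q (Suc w) a" using Suc.hyps(2) Suc.prems by (intro Suc.hyps(1)) auto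
  then show ?case using Suc.hyps(2) Suc.prems e by (intro linked_step[of E w "Suc w"]) auto
qed

lemma linked_wrap_down:
  assumes "w < d" "d < n" "\<And>i. i \<le> w \<Longrightarrow> i \<notin> Q" "\<And>i. d < i \<Longrightarrow> i < n \<Longrightarrow> i \<notin> Q"
  shows "linked E Q w d"
  using assms(1,3)
proof (induction w)
  case 0
  then have e: "E 0 (n - 1)" using ends_edge assms by auto
  show ?case
  proof (cases "d = n - 1")
    case False
    then have "linked E Q (n - 1) d" using 0 assms by (intro linked_down) auto
    then show ?thesis using e 0 assms False by (intro linked_step[of E 0 "n - 1"]) auto
  qed (use e in \<open>simp add: linked_edge\<close>)
next
  case (Suc w)
  then have e: "E (Suc w) w" using path_edge sym assms(2) by auto
  have "linked E Q w d" using Suc by auto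
  then show ?case using Suc.prems e by (intro linked_step[of E "Suc w" w]) auto
qed

lemma linked_mono: "linked E Q w x \<Longrightarrow> (\<And>i j. E i j \<Longrightarrow> F i j) \<Longrightarrow> linked F Q w x"
  unfolding linked_def using rtrancl_mono[of "{(s, t). E s t \<and> s \<notin> Q \<and> t \<notin> Q}" "{(s, t). F s t \<and> s \<notin> Q \<and> t \<notin> Q}"]
  by blast

text \<open>An edge joining two vertices in different arcs of the crossing pair \<open>ac\<close>, \<open>bd\<close> would link one of
  them to three of \<open>a\<close>, \<open>b\<close>, \<open>c\<close>, \<open>d\<close>.\<close>

theorem rigid:
  fixes \<sigma> :: "nat \<Rightarrow> 'b::linorder"
  assumes sub: "\<And>i j. E i j \<Longrightarrow> F i j"
    and Fsym: "\<And>i j. F i j \<Longrightarrow> F j i" and Fbound: "\<And>i j. F i j \<Longrightarrow> i < n" and Firr: "\<And>i. \<not> F i i"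
    and Fone: "\<And>i j k l k' l'. F i j \<Longrightarrow> F k l \<Longrightarrow> F k' l' \<Longrightarrow> interleave (\<sigma> i) (\<sigma> j) (\<sigma> k) (\<sigma> l) \<Longrightarrow>
       interleave (\<sigma> i) (\<sigma> j) (\<sigma> k') (\<sigma> l') \<Longrightarrow> {k, l} = {k', l'}"
    and inj: "inj_on \<sigma> {..<n}"
    and uv: "F u v"
  shows "E u v"
proof (rule ccontr)
  assume nE: "\<not> E u v"
  have "u < n" "v < n" "u \<noteq> v" using uv Fbound Fsym Firr by blast+
  then obtain k l k' l' where kl: "E k l" "E k' l'" "interleave u v k l" "interleave k l k' l'"
    using separated nE by blast
  obtain a b c d where q: "E a c" "E b d" "a < b" "b < c" "c < d"
    "{k, l} = {a, c} \<and> {k', l'} = {b, d} \<or> {k, l} = {b, d} \<and> {k', l'} = {a, c}"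
    using ordered_crossing[OF kl(1,2,4)] by metis
  have il: "interleave u v a c \<or> interleave u v b d"
    using q(6) kl(3) by (auto simp: doubleton_eq_iff interleave_swap)
  have K4: "E a b" "E b c" "E c d" "E a d" using sides[OF q(1-5)] by auto
  let ?Q = "{a, b, c, d}"
  have "d < n" using bound' q by blast
  \<comment> \<open>The arc of the boundary cycle containing \<open>w\<close> leads to both of its
    ends; for the outer arc, between \<open>d\<close> and \<open>a\<close>, the walk wraps
    around.\<close>
  have ends: "linked F ?Q w a \<and> linked F ?Q w d \<and> (w < a \<or> d < w) \<or>
      linked F ?Q w a \<and> linked F ?Q w b \<and> a < w \<and> w < b \<or>
      linked F ?Q w b \<and> linked F ?Q w c \<and> b < w \<and> w < c \<or>
      linked F ?Q w c \<and> linked F ?Q w d \<and> c < w \<and> w < d" if w: "w < n" "w \<notin> ?Q" for w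
  proof -
    have lm: "linked F ?Q w x" if "linked E ?Q w x" for x
      using that by (rule linked_mono) (rule sub)
    consider "w < a" | "d < w" | "a < w" "w < b" | "b < w" "w < c" | "c < w" "w < d"
      using w(2) by fastforce
    then show ?thesis
    proof cases
      case 1
      have "linked E ?Q w a" by (rule linked_up) (use 1 q(3-5) \<open>d < n\<close> in auto)
      moreover have "linked E ?Q w d" by (rule linked_wrap_down) (use 1 q(3-5) \<open>d < n\<close> in auto)
      ultimately show ?thesis using 1 lm by blast
    next
      case 2
      have "linked E ?Q w d" by (rule linked_down) (use 2 q(3-5) w in auto)
      moreover have "linked E ?Q w a" by (rule linked_wrap_up) (use 2 q(3-5) w in auto)
      ultimately show ?thesis using 2 lm by blast
    next
      case 3
      have "linked E ?Q w a" by (rule linked_down) (use 3 q(3-5) w in auto)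
      moreover have "linked E ?Q w b" by (rule linked_up) (use 3 q(3-5) \<open>d < n\<close> in auto)
      ultimately show ?thesis using 3 lm by blast
    next
      case 4
      have "linked E ?Q w b" by (rule linked_down) (use 4 q(3-5) w in auto)
      moreover have "linked E ?Q w c" by (rule linked_up) (use 4 q(3-5) \<open>d < n\<close> in auto)
      ultimately show ?thesis using 4 lm by blast
    next
      case 5
      have "linked E ?Q w c" by (rule linked_down) (use 5 q(3-5) w in auto)
      moreover have "linked E ?Q w d" by (rule linked_up) (use 5 q(3-5) \<open>d < n\<close> in auto)
      ultimately show ?thesis using 5 lm by blast
    qed
  qed
  have main: False if uv: "F u v" "u \<notin> ?Q" and il: "interleave u v a c \<or> interleave u v b d" for u v
  proof -
    have n: "u < n" "v < n" using uv Fbound Fsym by blast+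
    have no3: "\<not> (linked F ?Q u x \<and> linked F ?Q u y \<and> linked F ?Q u z)"
      if "{x, y, z} \<subseteq> ?Q" "x \<noteq> y" "y \<noteq> z" "x \<noteq> z" for x y z
    proof
      assume L: "linked F ?Q u x \<and> linked F ?Q u y \<and> linked F ?Q u z"
      show False
      proof (rule linked_K4[of F "{..<n}" \<sigma> a b c d u x y z])
        show "F i j \<Longrightarrow> F j i" for i j by (rule Fsym)
        show "F i j \<Longrightarrow> i \<in> {..<n}" for i j using Fbound by blast
        show "\<not> F i i" for i by (rule Firr)
        show "F i j \<Longrightarrow> F k l \<Longrightarrow> F k' l' \<Longrightarrow> interleave (\<sigma> i) (\<sigma> j) (\<sigma> k) (\<sigma> l) \<Longrightarrow>
          interleave (\<sigma> i) (\<sigma> j) (\<sigma> k') (\<sigma> l') \<Longrightarrow> {k, l} = {k', l'}" for i j k l k' l'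
          by (rule Fone[of i j k l k' l'])
      qed (use that uv(2) sub q K4 inj L in auto)
    qed
    have no: "\<not> (linked F ?Q u a \<and> linked F ?Q u b \<and> linked F ?Q u c)"
      "\<not> (linked F ?Q u a \<and> linked F ?Q u b \<and> linked F ?Q u d)"
      "\<not> (linked F ?Q u a \<and> linked F ?Q u c \<and> linked F ?Q u d)"
      "\<not> (linked F ?Q u b \<and> linked F ?Q u c \<and> linked F ?Q u d)"
      using q by (intro no3; simp)+
    \<comment> \<open>Through the edge \<open>uv\<close>, \<open>u\<close> is linked to
      \<open>v\<close> itself if \<open>v\<close> lies in the K_4, and otherwise inherits the two
      links of \<open>v\<close>. Since \<open>uv\<close> crosses a diagonal, this adds a third
      vertex to the two of the arc of \<open>u\<close>.\<close>
    have v: "v = a \<and> linked F ?Q u a \<or> v = b \<and> linked F ?Q u b \<or> v = c \<and> linked F ?Q u c \<or>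
      v = d \<and> linked F ?Q u d \<or>
      linked F ?Q u a \<and> linked F ?Q u d \<and> (v < a \<or> d < v) \<or>
      linked F ?Q u a \<and> linked F ?Q u b \<and> a < v \<and> v < b \<or>
      linked F ?Q u b \<and> linked F ?Q u c \<and> b < v \<and> v < c \<or>
      linked F ?Q u c \<and> linked F ?Q u d \<and> c < v \<and> v < d"
    proof (cases "v \<in> ?Q")
      case True
      have "linked F ?Q u v" using uv by (rule_tac linked_edge)
      then show ?thesis using True by auto
    next
      case False
      have "linked F ?Q u x" if "linked F ?Q v x" for x
        using linked_step[of F u v ?Q x] uv False that by blast
      then show ?thesis using ends[OF n(2) False] by blast
    qed
    show False
      using ends[OF n(1) uv(2)] v il no q(3-5) unfolding interleave_xor
      by (elim disjE conjE; simp)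
  qed
  \<comment> \<open>All pairs inside the K_4 are edges already, so the non-edge \<open>uv\<close>
    has an end outside.\<close>
  have "u \<notin> ?Q \<or> v \<notin> ?Q"
    using nE \<open>u \<noteq> v\<close> K4 q sym by auto
  then show False
    using main[OF uv _ il] main[OF Fsym[OF uv]] il interleave_swap(1) by blast
qed

end

text \<open>\<open>sk\<close> skips the vertices strictly between \<open>x\<close> and
  \<open>y\<close>. As \<open>xy\<close> is uncrossed, an edge at a skipped vertex stays within the
  interval from \<open>x\<close> to \<open>y\<close> and cannot cross a pair outside its interior.
  So the crossed edge witnessing \<open>separated\<close>, and then the edge crossing it,
  survive.\<close>

lemma (in maximal_order) leaf_removed:
  assumes xy: "E x y" "uncrossed x y" "x < y"
  defines "m \<equiv> n - (y - x - 1)" and "sk \<equiv> \<lambda>i. if i \<le> x then i else i + (y - x - 1)"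
  shows "saturated_order m (\<lambda>i j. E (sk i) (sk j))"
proof
  have yn: "y < n" using bound2 xy by blast
  have sk_less: "sk i < sk j \<longleftrightarrow> i < j" and sk_eq: "sk i = sk j \<longleftrightarrow> i = j" for i j
    by (auto simp: sk_def)
  have skn: "sk i < n \<longleftrightarrow> i < m" for i using yn xy(3) by (auto simp: sk_def m_def)
  have il: "interleave (sk i) (sk j) (sk k) (sk l) \<longleftrightarrow> interleave i j k l" for i j k l
    by (rule interleave_mono_on) (simp_all add: sk_less sk_eq)
  have out: "sk i \<le> x \<or> y \<le> sk i" for i using xy(3) by (auto simp: sk_def)
  have surj: "\<exists>i<m. sk i = j" if "j < n" "j \<le> x \<or> y \<le> j" for j
  proof (cases "j \<le> x")
    case True then show ?thesis using xy(3) yn by (intro exI[of _ j]) (auto simp: sk_def m_def)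
  next
    case False
    then show ?thesis using that xy(3) yn by (intro exI[of _ "j - (y - x - 1)"]) (auto simp: sk_def m_def)
  qed
  show "E (sk i) (sk j) \<Longrightarrow> E (sk j) (sk i)" for i j by (rule sym)
  show "E (sk i) (sk j) \<Longrightarrow> i < m" for i j using bound skn by blast
  show "\<not> E (sk i) (sk i)" for i by (rule irrefl)
  show "{k, l} = {k', l'}" if "E (sk i) (sk j)" "E (sk k) (sk l)" "E (sk k') (sk l')" "interleave i j k l" "interleave i j k' l'"
    for i j k l k' l'
    using one[OF that(1-3)] that(4,5) by (auto simp: il doubleton_eq_iff sk_eq)
  show "E (sk i) (sk (Suc i))" if "Suc i < m" for i
  proof -
    \<comment> \<open>The only new pair of consecutive vertices is \<open>x\<close>,
      \<open>y\<close>, which the edge \<open>xy\<close> joins.\<close>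
    consider "i < x" | "i = x" | "x < i" by linarith
    then show ?thesis
    proof cases
      case 1 then show ?thesis using path_edge[of i] yn xy(3) by (simp add: sk_def)
    next
      case 2 then show ?thesis using xy by (simp add: sk_def)
    next
      case 3 then show ?thesis using path_edge[of "sk i"] skn[of "Suc i"] that by (simp add: sk_def)
    qed
  qed
  show "E (sk 0) (sk (m - 1))" if "2 \<le> m"
  proof -
    have "sk (m - 1) = n - 1" using yn xy(3) by (auto simp: sk_def m_def)
    moreover have "sk 0 = 0" by (simp add: sk_def)
    moreover have "2 \<le> n" using that by (simp add: m_def)
    ultimately show ?thesis using ends_edge by simp
  qed
  show "E (sk a) (sk b) \<and> E (sk b) (sk c) \<and> E (sk c) (sk d) \<and> E (sk a) (sk d)"
    if "E (sk a) (sk c)" "E (sk b) (sk d)" "a < b" "b < c" "c < d" for a b c d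
    using crossing_sides(5-8)[OF that(1,2)] that sk_less by simp
  show "\<exists>k l k' l'. E (sk k) (sk l) \<and> E (sk k') (sk l') \<and> interleave u v k l \<and> interleave k l k' l'"
    if uv: "u < m" "v < m" "u \<noteq> v" "\<not> E (sk u) (sk v)" for u v
  proof -
    obtain k l k' l' where kl: "E k l" "E k' l'" "interleave (sk u) (sk v) k l" "interleave k l k' l'"
      using nonadjacent_crosses_crossed[of "sk u" "sk v"] uv skn sk_eq by blast
    have inner: "x \<le> i \<and> i \<le> y \<and> x \<le> j \<and> j \<le> y" if "E i j" "x < i \<and> i < y \<or> x < j \<and> j < y" for i j
      using uncrossedD[OF xy(2) that(1)] that(2) xy(3) unfolding interleave_xor by linarith
    have kl_out: "\<not> (x < k \<and> k < y)" "\<not> (x < l \<and> l < y)"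
      using inner[OF kl(1)] kl(3) out[of u] out[of v] by (auto simp: interleave_cases)
    then have "\<not> (x < k' \<and> k' < y)" "\<not> (x < l' \<and> l' < y)"
      using inner[OF kl(2)] kl(4) by (auto simp: interleave_cases)
    then obtain k0 l0 k1 l1 where "sk k0 = k" "sk l0 = l" "sk k1 = k'" "sk l1 = l'"
      using surj kl_out kl(1,2) bound bound2 by (meson not_less)
    then show ?thesis using kl by (intro exI[of _ k0] exI[of _ l0] exI[of _ k1] exI[of _ l1]) (auto simp: il)
  qed
qed

section \<open>Pseudo-outerplanar graphs as ordered graphs\<close>

lemma one_crossing_order_cong:
  assumes "simple_graph G" "one_crossing_order p G" "inj_on q (verts G)"
    and "\<And>a c b d. {a, c, b, d} \<subseteq> verts G \<Longrightarrow> interleave (q a) (q c) (q b) (q d) \<longleftrightarrow> interleave (p a) (p c) (p b) (p d)"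
  shows "one_crossing_order q G"
proof -
  have "crosses q e f \<longleftrightarrow> crosses p e f" if "e \<in> edges G" "f \<in> edges G" for e f
    using assms(1) that by (intro crosses_cong[of "verts G"] assms(4)) (auto simp: simple_graph_def)
  then show ?thesis using assms(2,3) by (simp add: one_crossing_order_def)
qed

lemma one_crossing_order_strict_mono:
  assumes "simple_graph G" "one_crossing_order p G" "\<And>x y. f x < f y \<longleftrightarrow> x < y" "inj f"
  shows "one_crossing_order (\<lambda>v. f (p v)) G"
proof (rule one_crossing_order_cong[OF assms(1,2)])
  show "inj_on (\<lambda>v. f (p v)) (verts G)"
    using assms(2,4) by (auto simp: one_crossing_order_def inj_on_def)
  show "interleave (f (p a)) (f (p c)) (f (p b)) (f (p d)) \<longleftrightarrow> interleave (p a) (p c) (p b) (p d)" for a b c d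
    by (rule interleave_mono_on) (simp_all add: assms(3) inj_eq[OF assms(4)])
qed

lemma simple_subgraph: "simple_graph G \<Longrightarrow> subgraph B G \<Longrightarrow> simple_graph B"
  by (simp add: subgraph_def)

lemma subgraph_trans: "subgraph B C \<Longrightarrow> subgraph C G \<Longrightarrow> subgraph B G"
  by (auto simp: subgraph_def)

lemma finite_edges: "simple_graph G \<Longrightarrow> finite (edges G)"
  by (rule finite_subset[of _ "Pow (verts G)"]) (auto simp: simple_graph_def)

lemma block_subgraph:
  assumes "simple_graph G" "block G B"
  shows "subgraph B G"
  using assms(2) unfolding block_def
proof
  assume "\<exists>e. bridge G e \<and> B = (e, {e})"
  then obtain e where "e \<in> edges G" "B = (e, {e})" by (auto simp: bridge_def)
  then show ?thesis using assms(1) by (auto simp: subgraph_def simple_graph_def intro: finite_subset)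
qed simp

text \<open>\<open>arctan\<close> squeezes the order into less than a full turn, so straight chords
  between these angles draw every block.\<close>

lemma one_crossing_order_pseudo_outerplanar:
  fixes p :: "'a \<Rightarrow> real"
  assumes "simple_graph G" "one_crossing_order p G"
  shows "pseudo_outerplanar G"
  unfolding pseudo_outerplanar_def
proof (intro conjI allI impI assms)
  fix B assume "block G B"
  then have B: "subgraph B G" using block_subgraph assms by blast
  then have S: "simple_graph B" using assms simple_subgraph by blast
  have o: "one_crossing_order (\<lambda>v. arctan (p v)) B"
    by (rule one_crossing_order_strict_mono[OF S one_crossing_order_subgraph[OF assms(2) B]])
      (auto simp: arctan_less_iff arctan_eq_iff inj_on_def)
  have "\<bar>arctan x - arctan y\<bar> < 2 * pi" for x y
    using arctan_bounded[of x] arctan_bounded[of y] by auto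
  then interpret vertex_angles B "\<lambda>v. arctan (p v)"
    using o S by unfold_locales (auto simp: one_crossing_order_def)
  show "\<exists>d. pseudo_outerplanar_drawing B d"
    using chord_drawing_pseudo_outerplanar[OF o] by blast
qed

text \<open>A 2-connected subgraph extends to a largest one, which is a block, and the order read
  off the drawing of that block restricts. Size counts vertices and edges, so that it also grows
  when only edges are added.\<close>

lemma two_connected_subgraph_one_crossing_order:
  assumes PO: "pseudo_outerplanar G" and B: "subgraph B G" "two_connected B"
  shows "\<exists>p :: 'a \<Rightarrow> real. one_crossing_order p (B :: 'a graph)"
proof -
  have S: "simple_graph G" using PO by (simp add: pseudo_outerplanar_def)
  define f where "f C = card (verts C) + card (edges C)" for C :: "'a graph"
  define P where "P C \<longleftrightarrow> subgraph C G \<and> two_connected C \<and> subgraph B C" for C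
  have fle: "f C \<le> f D" if "subgraph C D" "simple_graph D" for C D
    unfolding f_def using that finite_edges[of D]
    by (intro add_mono card_mono) (auto simp: subgraph_def simple_graph_def)
  have "P B" using B by (auto simp: P_def subgraph_def)
  moreover have "\<forall>C. P C \<longrightarrow> f C \<le> f G" using fle S by (auto simp: P_def)
  ultimately have "\<exists>C. P C \<and> (\<forall>D. P D \<longrightarrow> f D \<le> f C)"
    using ex_has_greatest_nat[of P B f "Suc (f G)"] by (simp add: less_Suc_eq_le)
  then obtain C where C: "P C" and Cmax: "\<And>D. P D \<Longrightarrow> f D \<le> f C" by blast
  have "D = C" if D: "subgraph D G" "two_connected D" "subgraph C D" for D
  proof -
    have SD: "simple_graph D" using D by (simp add: subgraph_def)
    have "P D" using D C subgraph_trans unfolding P_def by blast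
    then have "f D \<le> f C" by (rule Cmax)
    moreover have sub: "verts C \<subseteq> verts D" "edges C \<subseteq> edges D" using D(3) by (auto simp: subgraph_def)
    moreover have fin: "finite (verts D)" "finite (edges D)" using SD finite_edges[OF SD] by (simp_all add: simple_graph_def)
    moreover have "card (verts C) \<le> card (verts D)" "card (edges C) \<le> card (edges D)"
      using sub fin by (auto intro: card_mono)
    ultimately have "card (verts C) = card (verts D)" "card (edges C) = card (edges D)"
      by (auto simp: f_def)
    then have "verts C = verts D" "edges C = edges D" using sub fin card_subset_eq by blast+
    then show ?thesis by (simp add: prod_eq_iff)
  qed
  then have "block G C" using C by (auto simp: block_def P_def)
  then obtain d where "pseudo_outerplanar_drawing C d" using PO unfolding pseudo_outerplanar_def by blast
  moreover have "simple_graph C" using C by (simp add: P_def subgraph_def)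
  ultimately have "one_crossing_order (\<lambda>v. Arg (point_of d v)) C"
    by (intro pseudo_outerplanar_drawing_one_crossing_order)
  then have "one_crossing_order (\<lambda>v. Arg (point_of d v)) B"
    by (rule one_crossing_order_subgraph) (use C in \<open>simp add: P_def\<close>)
  then show ?thesis by blast
qed

section \<open>Gluing orders at a separating vertex\<close>

lemma one_crossing_order_rotate_last:
  fixes p :: "'a \<Rightarrow> real"
  assumes S: "simple_graph G" and p: "one_crossing_order p G" and z: "z \<in> verts G"
  obtains q :: "'a \<Rightarrow> real" where "one_crossing_order q G" "q z = 0" "\<And>v. v \<in> verts G \<Longrightarrow> q v \<le> 0"
proof -
  have "finite (p ` verts G)" using S by (simp add: simple_graph_def)
  then obtain K where K: "\<And>v. v \<in> verts G \<Longrightarrow> \<bar>p v\<bar> \<le> K"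
    using finite_imp_bounded[of "p ` verts G"] by (auto simp: bounded_iff)
  \<comment> \<open>All values lie between \<open>- K\<close> and \<open>K\<close>, so a shift by
    \<open>2 * K + 1\<close> puts those after \<open>z\<close> below all others; subtracting
    \<open>p z\<close> then places \<open>z\<close> at 0, on top.\<close>
  define f where "f x = (if x \<le> p z then x else x - (2 * K + 1)) - p z" for x
  define q where "q v = f (p v)" for v
  have f: "p u \<noteq> p v \<Longrightarrow> f (p u) \<noteq> f (p v) \<and> (f (p u) < f (p v) \<longleftrightarrow> (p u < p v) \<noteq> ((p u \<le> p z) \<noteq> (p v \<le> p z)))"
    if "u \<in> verts G" "v \<in> verts G" for u v
    using K[OF that(1)] K[OF that(2)] by (auto simp: f_def)
  have "one_crossing_order q G"
  proof (rule one_crossing_order_cong[OF S p])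
    show "inj_on q (verts G)"
      using p f unfolding one_crossing_order_def inj_on_def q_def by metis
    fix a c b d assume "{a, c, b, d} \<subseteq> verts G"
    then show "interleave (q a) (q c) (q b) (q d) \<longleftrightarrow> interleave (p a) (p c) (p b) (p d)"
      unfolding q_def by (intro interleave_rotate[where P = "\<lambda>x. x \<le> p z"]) (use f in blast)
  qed
  moreover have "q z = 0" by (simp add: q_def f_def)
  moreover have "q v \<le> 0" if "v \<in> verts G" for v
    using K[OF that] K[OF z] by (auto simp: q_def f_def)
  ultimately show thesis by (rule that)
qed

text \<open>If \<open>G\<close> is disconnected, any third vertex can play the part of
  \<open>z\<close>; this is where three vertices are needed. \<open>A\<close> collects what remains
  reachable from \<open>u\<close> without \<open>z\<close>.\<close>

lemma not_two_connected_separation: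
  assumes S: "simple_graph G" and c: "card (verts G) \<ge> 3" and n: "\<not> two_connected G"
  obtains z A B where "verts G = insert z (A \<union> B)" "z \<notin> A" "z \<notin> B" "A \<inter> B = {}" "A \<noteq> {}" "B \<noteq> {}"
    "\<And>e. e \<in> edges G \<Longrightarrow> e \<subseteq> insert z A \<or> e \<subseteq> insert z B"
proof -
  have card_ne: "verts G - X \<noteq> {}" if "finite X" "card X \<le> 2" for X
  proof
    assume "verts G - X = {}"
    then have "card (verts G) \<le> card X" using that by (intro card_mono) auto
    then show False using c that by simp
  qed
  have "\<exists>z\<in>verts G. \<exists>u\<in>verts G - {z}. \<exists>v\<in>verts G - {z}. \<not> reachable (delete_vertex G z) u v"
  proof (cases "connected_graph G")
    case True
    then obtain z where "z \<in> verts G" "\<not> connected_graph (delete_vertex G z)"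
      using n c by (auto simp: two_connected_def)
    moreover have "verts G - {z} \<noteq> {}" using card_ne[of "{z}"] by simp
    ultimately show ?thesis unfolding connected_graph_def delete_vertex_def by auto
  next
    case False
    moreover have "verts G \<noteq> {}" using card_ne[of "{}"] by simp
    ultimately obtain u v where uv: "u \<in> verts G" "v \<in> verts G" "\<not> reachable G u v"
      by (auto simp: connected_graph_def)
    obtain z where z: "z \<in> verts G" "z \<noteq> u" "z \<noteq> v"
    proof -
      have "card {u, v} \<le> 2" by (cases "u = v") auto
      then show thesis using card_ne[of "{u, v}"] that by blast
    qed
    have "\<not> reachable (delete_vertex G z) u v"
    proof
      assume "reachable (delete_vertex G z) u v"
      then have "reachable G u v" unfolding reachable_def
        by (rule rtrancl_mono[THEN subsetD, rotated]) (auto simp: delete_vertex_def)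
      then show False using uv by simp
    qed
    then show ?thesis using uv z by blast
  qed
  then obtain z u v where z: "z \<in> verts G" "u \<in> verts G - {z}" "v \<in> verts G - {z}"
    "\<not> reachable (delete_vertex G z) u v" by blast
  define A where "A = {x \<in> verts G - {z}. reachable (delete_vertex G z) u x}"
  define B where "B = verts G - {z} - A"
  have step: "t \<in> A" if "{s, t} \<in> edges G" "s \<in> A" "t \<noteq> z" for s t
  proof -
    have "{s, t} \<subseteq> verts G" using that(1) S by (auto simp: simple_graph_def)
    moreover have "(s, t) \<in> {(a, b). {a, b} \<in> edges (delete_vertex G z)}"
      using that by (auto simp: delete_vertex_def A_def)
    then have "reachable (delete_vertex G z) u t"
      using that(2) unfolding A_def reachable_def by (blast intro: rtrancl_into_rtrancl)
    ultimately show ?thesis using that(3) by (simp add: A_def)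
  qed
  show thesis
  proof (rule that)
    show "verts G = insert z (A \<union> B)" "z \<notin> A" "z \<notin> B" "A \<inter> B = {}"
      using z by (auto simp: A_def B_def)
    have "u \<in> A" using z by (auto simp: A_def reachable_def)
    then show "A \<noteq> {}" by auto
    have "v \<in> B" using z by (auto simp: A_def B_def)
    then show "B \<noteq> {}" by auto
    fix e assume e: "e \<in> edges G"
    then have "card e = 2" "e \<subseteq> verts G" using S by (auto simp: simple_graph_def)
    then obtain s t where st: "e = {s, t}" "s \<in> verts G" "t \<in> verts G" by (auto simp: card_2_iff)
    have "{t, s} \<in> edges G" using e st by (simp add: insert_commute)
    then have "s \<in> A \<longleftrightarrow> t \<in> A" if "s \<noteq> z" "t \<noteq> z" using step e st(1) that by blast
    then show "e \<subseteq> insert z A \<or> e \<subseteq> insert z B" using st by (auto simp: B_def)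
  qed
qed

text \<open>With \<open>z\<close> at 0, \<open>A\<close> below and \<open>B\<close> above, the point
  0 separates any edge of one part from any edge of the other, so no new interleaving
  arises.\<close>

lemma one_crossing_order_merge:
  fixes p q :: "'a \<Rightarrow> real"
  assumes S: "simple_graph G"
    and V: "verts G = insert z (A \<union> B)" "z \<notin> A" "z \<notin> B" "A \<inter> B = {}"
    and E: "\<And>e. e \<in> edges G \<Longrightarrow> e \<subseteq> insert z A \<or> e \<subseteq> insert z B"
    and p: "one_crossing_order p (insert z A, {e \<in> edges G. e \<subseteq> insert z A})" "p z = 0" "\<And>v. v \<in> A \<Longrightarrow> p v \<le> 0"
    and q: "one_crossing_order q (insert z B, {e \<in> edges G. e \<subseteq> insert z B})" "q z = 0" "\<And>v. v \<in> B \<Longrightarrow> q v \<ge> 0"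
  shows "one_crossing_order (\<lambda>v. if v \<in> A then p v else q v) G"
proof -
  let ?r = "\<lambda>v. if v \<in> A then p v else q v"
  have injp: "inj_on p (insert z A)" and injq: "inj_on q (insert z B)" using p q by (auto simp: one_crossing_order_def)
  have pneg: "p v < 0" if "v \<in> A" for v
    using p(3)[OF that] injp p(2) that V(2) by (auto simp: inj_on_def order_less_le)
  have qpos: "q v > 0" if "v \<in> B" for v
    using q(3)[OF that] injq q(2) that V(3) by (auto simp: inj_on_def order_less_le)
  have rA: "?r v = p v \<and> ?r v \<le> 0" if "v \<in> insert z A" for v using that V p q by auto
  have rB: "?r v = q v \<and> ?r v \<ge> 0" if "v \<in> insert z B" for v using that V p q by auto
  have cA: "crosses ?r e f = crosses p e f" if "e \<subseteq> insert z A" "f \<subseteq> insert z A" for e f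
    by (rule crosses_cong[OF _ that]) (use rA in auto)
  have cB: "crosses ?r e f = crosses q e f" if "e \<subseteq> insert z B" "f \<subseteq> insert z B" for e f
    by (rule crosses_cong[OF _ that]) (use rB in auto)
  have mixed: "\<not> crosses ?r e f" if "e \<subseteq> insert z A" "f \<subseteq> insert z B" for e f
  proof
    assume "crosses ?r e f"
    then obtain a c b d where ef: "e = {a, c}" "f = {b, d}" and il: "interleave (?r a) (?r c) (?r b) (?r d)"
      unfolding crosses_def by blast
    have "a \<in> insert z A" "c \<in> insert z A" "b \<in> insert z B" "d \<in> insert z B" using ef that by blast+
    then have "?r a \<le> 0" "?r c \<le> 0" "?r b \<ge> 0" "?r d \<ge> 0" using rA rB by blast+
    then show False using il interleave_separated by blast
  qed
  have same: "e \<subseteq> insert z A \<and> f \<subseteq> insert z A \<or> e \<subseteq> insert z B \<and> f \<subseteq> insert z B"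
    if "e \<in> edges G" "f \<in> edges G" "crosses ?r e f" for e f
    using E[OF that(1)] E[OF that(2)] that(3) mixed crosses_sym by metis
  have both: "\<not> (e \<subseteq> insert z A \<and> e \<subseteq> insert z B)" if "e \<in> edges G" for e
  proof
    assume "e \<subseteq> insert z A \<and> e \<subseteq> insert z B"
    then have "e \<subseteq> {z}" using V by auto
    then have "card e \<le> 1" using card_mono[of "{z}" e] by simp
    then show False using S that by (auto simp: simple_graph_def)
  qed
  show ?thesis unfolding one_crossing_order_def
  proof (intro conjI ballI impI)
    show "inj_on ?r (verts G)"
    proof (rule inj_onI)
      fix x y assume xy: "x \<in> verts G" "y \<in> verts G" "?r x = ?r y"
      have *: "u \<in> A \<longleftrightarrow> ?r u < 0" if "u \<in> verts G" for u
        using that V pneg qpos q(2) by (auto simp: not_less order_le_less)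
      have "x \<in> A \<longleftrightarrow> y \<in> A" using * xy by metis
      then show "x = y"
        using xy V injp injq by (auto simp: inj_on_def split: if_splits)
    qed
    fix e f g assume efg: "e \<in> edges G" "f \<in> edges G" "g \<in> edges G" "crosses ?r e f \<and> crosses ?r e g"
    then consider "e \<subseteq> insert z A" "f \<subseteq> insert z A" "g \<subseteq> insert z A" | "e \<subseteq> insert z B" "f \<subseteq> insert z B" "g \<subseteq> insert z B"
      using same both by metis
    then show "f = g"
    proof cases
      case 1 then show ?thesis using p(1) efg cA unfolding one_crossing_order_def by simp
    next
      case 2 then show ?thesis using q(1) efg cB unfolding one_crossing_order_def by simp
    qed
  qed
qed

lemma two_connected_subgraphs_one_crossing_order:
  assumes "simple_graph G" "\<And>B. subgraph B G \<Longrightarrow> two_connected B \<Longrightarrow> \<exists>p :: 'a \<Rightarrow> real. one_crossing_order p B"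
  shows "\<exists>p :: 'a \<Rightarrow> real. one_crossing_order p (G :: 'a graph)"
  using assms
proof (induction "card (verts G)" arbitrary: G rule: less_induct)
  case less
  have fin: "finite (verts G)" using less.prems by (simp add: simple_graph_def)
  show ?case
  proof (cases "two_connected G")
    case True
    moreover have "subgraph G G" using less.prems by (simp add: subgraph_def)
    ultimately show ?thesis using less.prems by blast
  next
    case n: False
    show ?thesis
    proof (cases "card (verts G) \<ge> 3")
      case True
      obtain z A B where Z: "verts G = insert z (A \<union> B)" "z \<notin> A" "z \<notin> B" "A \<inter> B = {}" "A \<noteq> {}" "B \<noteq> {}"
        "\<And>e. e \<in> edges G \<Longrightarrow> e \<subseteq> insert z A \<or> e \<subseteq> insert z B"
        using not_two_connected_separation[OF less.prems(1) True n] by metis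
      have *: "\<exists>p :: 'a \<Rightarrow> real. one_crossing_order p (X, {e \<in> edges G. e \<subseteq> X})" if "X \<subset> verts G" for X
      proof (rule less.hyps)
        show "card (verts (X, {e \<in> edges G. e \<subseteq> X})) < card (verts G)"
          using that fin psubset_card_mono by simp
        have "subgraph (X, {e \<in> edges G. e \<subseteq> X}) G"
          using that fin less.prems(1) by (auto simp: subgraph_def simple_graph_def intro: finite_subset)
        then show "simple_graph (X, {e \<in> edges G. e \<subseteq> X})"
          "\<And>B. subgraph B (X, {e \<in> edges G. e \<subseteq> X}) \<Longrightarrow> two_connected B \<Longrightarrow> \<exists>p :: 'a \<Rightarrow> real. one_crossing_order p B"
          using less.prems(2) subgraph_trans by (blast intro: simple_subgraph less.prems(1))+
      qed
      have simple: "simple_graph (X, {e \<in> edges G. e \<subseteq> X})" if "X \<subseteq> verts G" for X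
        using that fin less.prems(1) by (auto simp: simple_graph_def intro: finite_subset)
      have last: "\<exists>q :: 'a \<Rightarrow> real. one_crossing_order q (X, {e \<in> edges G. e \<subseteq> X}) \<and> q z = 0 \<and> (\<forall>v\<in>X. q v \<le> 0)"
        if X: "X \<subset> verts G" "z \<in> X" for X
      proof -
        obtain p :: "'a \<Rightarrow> real" where p: "one_crossing_order p (X, {e \<in> edges G. e \<subseteq> X})"
          using *[OF X(1)] by blast
        have "simple_graph (X, {e \<in> edges G. e \<subseteq> X})" using X by (intro simple) auto
        from this p have "z \<in> verts (X, {e \<in> edges G. e \<subseteq> X}) \<Longrightarrow> ?thesis"
          by (rule one_crossing_order_rotate_last) auto
        then show ?thesis using X(2) by simp
      qed
      obtain a b where ab: "a \<in> A" "b \<in> B" using Z(5,6) by blast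
      then have "a \<notin> insert z B" "b \<notin> insert z A" using Z(2-4) by auto
      moreover have "a \<in> verts G" "b \<in> verts G" using ab Z(1) by auto
      moreover have "insert z A \<subseteq> verts G" "insert z B \<subseteq> verts G" using Z(1) by auto
      ultimately have sub: "insert z A \<subset> verts G" "insert z B \<subset> verts G" by auto
      obtain p :: "'a \<Rightarrow> real" where p: "one_crossing_order p (insert z A, {e \<in> edges G. e \<subseteq> insert z A})" "p z = 0"
        "\<And>v. v \<in> insert z A \<Longrightarrow> p v \<le> 0"
        using last[OF sub(1) insertI1] by auto
      obtain q :: "'a \<Rightarrow> real" where q: "one_crossing_order q (insert z B, {e \<in> edges G. e \<subseteq> insert z B})" "q z = 0"
        "\<And>v. v \<in> insert z B \<Longrightarrow> q v \<le> 0"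
        using last[OF sub(2) insertI1] by auto
      have SB: "simple_graph (insert z B, {e \<in> edges G. e \<subseteq> insert z B})" using sub(2) by (intro simple) auto
      have "inj_on q (insert z B)" using q(1) by (simp add: one_crossing_order_def)
      \<comment> \<open>Both orders have \<open>z\<close> last; reversing one of them makes
        \<open>z\<close> its first vertex, as merging requires.\<close>
      then have "one_crossing_order (\<lambda>v. - q v) (insert z B, {e \<in> edges G. e \<subseteq> insert z B})"
        by (intro one_crossing_order_cong[OF SB q(1)]) (auto simp: inj_on_def interleave_uminus)
      then have "one_crossing_order (\<lambda>v. if v \<in> A then p v else - q v) G"
        using p q by (intro one_crossing_order_merge[OF less.prems(1) Z(1-4,7)]) auto
      then show ?thesis by blast
    next
      case False
      obtain f :: "'a \<Rightarrow> nat" where f: "inj_on f (verts G)" using finite_imp_inj_to_nat_seg[OF fin] by blast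
      \<comment> \<open>Crossing edges are disjoint and so need four vertices, while fewer than
        three are present.\<close>
      have "\<not> crosses (\<lambda>v. real (f v)) e g" if "e \<in> edges G" "g \<in> edges G" for e g
      proof
        assume "crosses (\<lambda>v. real (f v)) e g"
        then have "e \<inter> g = {}" by (rule crosses_disjoint)
        moreover have "card e = 2" "card g = 2" "e \<union> g \<subseteq> verts G" using that less.prems(1) by (auto simp: simple_graph_def)
        moreover have "finite e" "finite g" using calculation by (auto intro: card_ge_0_finite)
        ultimately have "4 \<le> card (verts G)"
          using card_Un_disjoint[of e g] card_mono[OF fin, of "e \<union> g"] by simp
        then show False using False by simp
      qed
      then have "one_crossing_order (\<lambda>v. real (f v)) G" using f by (auto simp: one_crossing_order_def inj_on_def)
      then show ?thesis by blast
    qed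
  qed
qed

theorem pseudo_outerplanar_iff_order:
  fixes G :: "'a graph"
  shows "pseudo_outerplanar G \<longleftrightarrow> simple_graph G \<and> (\<exists>p :: 'a \<Rightarrow> real. one_crossing_order p G)"
  using one_crossing_order_pseudo_outerplanar two_connected_subgraphs_one_crossing_order two_connected_subgraph_one_crossing_order
  unfolding pseudo_outerplanar_def by metis

section \<open>From vertices to positions in the order\<close>

lemma one_crossing_order_enumeration:
  fixes p :: "'a \<Rightarrow> 'b::linorder"
  assumes "finite V" "inj_on p V"
  obtains w where "bij_betw w {..<card V} V" "\<And>i j. i < card V \<Longrightarrow> j < card V \<Longrightarrow> p (w i) < p (w j) \<longleftrightarrow> i < j"
proof -
  define xs where "xs = sorted_list_of_set (p ` V)"
  have xs: "set xs = p ` V" "sorted_wrt (<) xs" "length xs = card V" "distinct xs"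
    using assms by (simp_all add: xs_def card_image)
  define w where "w i = inv_into V p (xs ! i)" for i
  have pw: "p (w i) = xs ! i" "w i \<in> V" if "i < card V" for i
  proof -
    have "xs ! i \<in> p ` V" using that xs nth_mem by metis
    then show "p (w i) = xs ! i" "w i \<in> V" by (auto simp: w_def f_inv_into_f inv_into_into)
  qed
  have less: "p (w i) < p (w j)" if "i < j" "j < card V" for i j
    using sorted_wrt_nth_less[OF xs(2) that(1)] that xs(3) pw by simp
  have iff: "p (w i) < p (w j) \<longleftrightarrow> i < j" if "i < card V" "j < card V" for i j
    using less[of i j] less[of j i] that by (cases i j rule: linorder_cases) auto
  have "inj_on w {..<card V}"
  proof (rule inj_onI)
    fix i j assume ij: "i \<in> {..<card V}" "j \<in> {..<card V}" "w i = w j"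
    then show "i = j" using iff[of i j] iff[of j i] by (cases i j rule: linorder_cases) auto
  qed
  moreover have "w ` {..<card V} \<subseteq> V" using pw by auto
  ultimately have "bij_betw w {..<card V} V"
    using assms(1) card_subset_eq[of V "w ` {..<card V}"] by (simp add: bij_betw_def card_image)
  then show thesis using iff by (rule that)
qed

text \<open>If a pair \<open>ij\<close> meets both conditions of \<open>maximal\<close>, the same
  order stays admissible after the edge is added, which contradicts maximality unless the edge is
  already there.\<close>

lemma maximal_pseudo_outerplanar_order:
  assumes G: "maximal_pseudo_outerplanar (G :: 'a graph)"
  defines "n \<equiv> card (verts G)"
  obtains w where "bij_betw w {..<n} (verts G)"
    "maximal_order n (\<lambda>i j. i < n \<and> j < n \<and> {w i, w j} \<in> edges G)"
proof -
  have S: "simple_graph G" using G by (simp add: maximal_pseudo_outerplanar_def pseudo_outerplanar_def)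
  obtain p :: "'a \<Rightarrow> real" where p: "one_crossing_order p G"
    using G by (auto simp: maximal_pseudo_outerplanar_def pseudo_outerplanar_iff_order)
  have "finite (verts G)" "inj_on p (verts G)" using S p by (simp_all add: simple_graph_def one_crossing_order_def)
  then obtain w where w: "bij_betw w {..<n} (verts G)" and
    less: "\<And>i j. i < n \<Longrightarrow> j < n \<Longrightarrow> p (w i) < p (w j) \<longleftrightarrow> i < j"
    unfolding n_def by (rule one_crossing_order_enumeration) blast
  have weq: "w i = w j \<longleftrightarrow> i = j" if "i < n" "j < n" for i j
    using w that by (auto simp: bij_betw_def inj_on_def)
  have wV: "w i \<in> verts G" if "i < n" for i using w that by (auto simp: bij_betw_def)
  have peq: "p (w i) = p (w j) \<longleftrightarrow> i = j" if "i < n" "j < n" for i j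
    using less[OF that] less[OF that(2,1)] by auto
  have il: "interleave (p (w i)) (p (w j)) (p (w k)) (p (w l)) \<longleftrightarrow> interleave i j k l"
    if "i < n" "j < n" "k < n" "l < n" for i j k l
    by (rule interleave_mono_on[where f = "\<lambda>i. p (w i)"]) (use that in \<open>auto simp: less peq\<close>)
  have seteq: "{w i, w j} = {w k, w l} \<longleftrightarrow> {i, j} = {k, l}"
    if "i < n" "j < n" "k < n" "l < n" for i j k l
    using that by (simp add: doubleton_eq_iff weq)
  have edgeE: "\<exists>i j. i < n \<and> j < n \<and> e = {w i, w j}" if "e \<in> edges G" for e
  proof -
    have "card e = 2" "e \<subseteq> verts G" using S that by (auto simp: simple_graph_def)
    then obtain a b where "e = {a, b}" "a \<in> verts G" "b \<in> verts G" by (auto simp: card_2_iff)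
    moreover have "verts G = w ` {..<n}" using w by (simp add: bij_betw_def)
    ultimately show ?thesis by auto
  qed
  let ?E = "\<lambda>i j. i < n \<and> j < n \<and> {w i, w j} \<in> edges G"
  have "maximal_order n ?E"
  proof
    show "?E j i" if "?E i j" for i j using that by (simp add: insert_commute)
    show "i < n" if "?E i j" for i j using that by simp
    show "\<not> ?E i i" for i using S by (auto simp: simple_graph_def)
    show "{k, l} = {k', l'}" if "?E i j" "?E k l" "?E k' l'" "interleave i j k l" "interleave i j k' l'"
      for i j k l k' l'
    proof -
      have "crosses p {w i, w j} {w k, w l}" "crosses p {w i, w j} {w k', w l'}"
        using that by (simp_all add: il)
      then have "{w k, w l} = {w k', w l'}" using p that unfolding one_crossing_order_def by blast
      then show ?thesis using that by (simp add: seteq)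
    qed
    fix i j assume ij: "i < n" "j < n" "i \<noteq> j" and
      1: "\<And>k l k' l'. ?E k l \<Longrightarrow> ?E k' l' \<Longrightarrow> interleave i j k l \<Longrightarrow> interleave i j k' l' \<Longrightarrow> {k, l} = {k', l'}" and
      2: "\<And>k l k' l'. ?E k l \<Longrightarrow> ?E k' l' \<Longrightarrow> interleave i j k l \<Longrightarrow> interleave k l k' l' \<Longrightarrow> False"
    let ?e = "{w i, w j}"
    have c1: "f = g" if fg: "f \<in> edges G" "g \<in> edges G" "crosses p ?e f" "crosses p ?e g" for f g
    proof -
      obtain k l k' l' where "k < n" "l < n" "f = {w k, w l}" "k' < n" "l' < n" "g = {w k', w l'}"
        using edgeE[OF fg(1)] edgeE[OF fg(2)] by blast
      then show ?thesis using 1[of k l k' l'] fg ij by (simp add: il seteq)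
    qed
    have c2: False if fg: "f \<in> edges G" "g \<in> edges G" "crosses p ?e f" "crosses p f g" for f g
    proof -
      obtain k l k' l' where "k < n" "l < n" "f = {w k, w l}" "k' < n" "l' < n" "g = {w k', w l'}"
        using edgeE[OF fg(1)] edgeE[OF fg(2)] by blast
      then show ?thesis using 2[of k l k' l'] fg ij by (simp add: il)
    qed
    have "{w i, w j} \<in> edges G"
    proof (rule ccontr)
      assume new: "{w i, w j} \<notin> edges G"
      have "one_crossing_order p (add_edge G ?e)"
        unfolding one_crossing_order_def
      proof (intro conjI ballI impI)
        show "inj_on p (verts (add_edge G ?e))" using p by (simp add: one_crossing_order_def add_edge_def)
        fix e f g assume efg: "e \<in> edges (add_edge G ?e)" "f \<in> edges (add_edge G ?e)" "g \<in> edges (add_edge G ?e)"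
          "crosses p e f \<and> crosses p e g"
        then have mem: "e = ?e \<or> e \<in> edges G" "f = ?e \<or> f \<in> edges G" "g = ?e \<or> g \<in> edges G"
          by (auto simp: add_edge_def)
        have cr: "crosses p e f" "crosses p e g" "crosses p f e" "crosses p g e"
          using efg(4) crosses_sym[of p e f] crosses_sym[of p e g] by simp_all
        show "f = g"
        \<comment> \<open>The new edge may be the one crossed twice, handled by \<open>c1\<close>,
          or one of the two edges crossing an old one, handled by \<open>c2\<close>.\<close>
        proof (cases "e = ?e")
          case True
          then have "f \<in> edges G" "g \<in> edges G" using cr crosses_ne mem by metis+
          then show ?thesis using c1 cr True by blast
        next
          case False
          then have e: "e \<in> edges G" using mem by blast
          show ?thesis
          proof (cases "f = ?e")
            case True
            then show ?thesis using c2[OF e] cr mem by blast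
          next
            case f: False
            show ?thesis
            proof (cases "g = ?e")
              case True
              then show ?thesis using c2[OF e] cr mem f by blast
            next
              case g: False
              then have "f \<in> edges G" "g \<in> edges G" using f mem by blast+
              then show ?thesis using p e cr(1,2) unfolding one_crossing_order_def by blast
            qed
          qed
        qed
      qed
      moreover have "simple_graph (add_edge G ?e)"
        using S wV[OF ij(1)] wV[OF ij(2)] weq[OF ij(1,2)] ij(3) by (auto simp: simple_graph_def add_edge_def)
      ultimately have "pseudo_outerplanar (add_edge G ?e)"
        by (auto simp: pseudo_outerplanar_iff_order)
      moreover have "\<not> pseudo_outerplanar (add_edge G ?e)"
        using G new wV[OF ij(1)] wV[OF ij(2)] weq[OF ij(1,2)] ij(3) unfolding maximal_pseudo_outerplanar_def by blast
      ultimately show False by blast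
    qed
    then show "?E i j" using ij by simp
  qed
  with w show thesis by (rule that)
qed

section \<open>Diagrams of saturated graphs\<close>

lemma reachable_edge: "{u, v} \<in> edges G \<Longrightarrow> reachable G u v"
  unfolding reachable_def by (intro r_into_rtrancl) simp

lemma reachable_trans: "reachable G u v \<Longrightarrow> reachable G v w \<Longrightarrow> reachable G u w"
  unfolding reachable_def by (rule rtrancl_trans)

lemma reachable_sym: "reachable G u v \<Longrightarrow> reachable G v u"
proof -
  have "sym {(a, b). {a, b} \<in> edges G}" by (auto simp: sym_def insert_commute)
  then have "sym ({(a, b). {a, b} \<in> edges G}\<^sup>*)" by (rule sym_rtrancl)
  then show "reachable G u v \<Longrightarrow> reachable G v u" unfolding reachable_def by (rule symD)
qed

lemma connected_graphI:
  assumes "z \<in> verts G" "\<And>v. v \<in> verts G \<Longrightarrow> reachable G v z"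
  shows "connected_graph G"
  unfolding connected_graph_def
proof (intro conjI ballI)
  show "reachable G u v" if "u \<in> verts G" "v \<in> verts G" for u v
    using assms(2)[OF that(1)] reachable_sym[OF assms(2)[OF that(2)]] by (rule reachable_trans)
qed (use assms(1) in auto)

locale saturated_graph = saturated_order n E
  for n :: nat and E :: "nat \<Rightarrow> nat \<Rightarrow> bool" +
  fixes G :: "'a graph" and w :: "nat \<Rightarrow> 'a"
  assumes simple: "simple_graph G" and bij: "bij_betw w {..<n} (verts G)" and two: "n \<ge> 2"
    and E_iff: "E i j \<longleftrightarrow> i < n \<and> j < n \<and> {w i, w j} \<in> edges G"
begin

lemma w_eq: "i < n \<Longrightarrow> j < n \<Longrightarrow> w i = w j \<longleftrightarrow> i = j"
  using bij by (auto simp: bij_betw_def inj_on_def)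

lemma verts_eq: "verts G = w ` {..<n}"
  using bij by (simp add: bij_betw_def)

lemma edge_idxE:
  assumes "e \<in> edges G"
  obtains i j where "e = {w i, w j}" "E i j" "i < n" "j < n"
proof -
  have "card e = 2" "e \<subseteq> verts G" using simple assms by (auto simp: simple_graph_def)
  then obtain a b where "e = {a, b}" "a \<in> verts G" "b \<in> verts G" by (auto simp: card_2_iff)
  then show thesis using that assms unfolding verts_eq E_iff by auto
qed

definition idx :: "'a \<Rightarrow> nat" where "idx = inv_into {..<n} w"

lemma idx_w [simp]: "i < n \<Longrightarrow> idx (w i) = i"
  using bij unfolding idx_def by (auto simp: bij_betw_def inv_into_f_f)

text \<open>The minus sign makes increasing positions run clockwise; \<open>arctan\<close> keeps all
  angles within one turn.\<close>

definition angle :: "'a \<Rightarrow> real" where "angle v = arctan (- real (idx v))"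

lemma interleave_angle:
  assumes "i < n" "j < n" "k < n" "l < n"
  shows "interleave (angle (w i)) (angle (w j)) (angle (w k)) (angle (w l)) \<longleftrightarrow> interleave i j k l"
proof -
  have "interleave (angle (w i)) (angle (w j)) (angle (w k)) (angle (w l)) \<longleftrightarrow>
      interleave (- real i) (- real j) (- real k) (- real l)"
    using assms by (auto simp: interleave_def min_def max_def angle_def arctan_less_iff arctan_le_iff)
  also have "\<dots> \<longleftrightarrow> interleave i j k l"
    unfolding interleave_uminus by (rule interleave_mono_on) auto
  finally show ?thesis .
qed

lemma one_crossing_order_angle: "one_crossing_order angle G"
  unfolding one_crossing_order_def
proof (intro conjI ballI impI)
  show "inj_on angle (verts G)"
    unfolding verts_eq by (rule inj_onI) (auto simp: angle_def arctan_eq_iff)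
  fix e f g assume "e \<in> edges G" "f \<in> edges G" "g \<in> edges G" and c: "crosses angle e f \<and> crosses angle e g"
  then obtain i j k l k' l' where "e = {w i, w j}" "E i j" "f = {w k, w l}" "E k l" "g = {w k', w l'}" "E k' l'"
    by (metis edge_idxE)
  moreover from this have "i < n" "j < n" "k < n" "l < n" "k' < n" "l' < n" by (auto simp: E_iff)
  ultimately show "f = g" using one[of i j k l k' l'] c
    by (auto simp: interleave_angle doubleton_eq_iff)
qed

sublocale vertex_angles G angle
proof
  show "simple_graph G" by (rule simple)
  show "inj_on angle (verts G)" using one_crossing_order_angle by (simp add: one_crossing_order_def)
  show "\<bar>angle u - angle v\<bar> < 2 * pi" for u v
    using arctan_bounded[of "- real (idx u)"] arctan_bounded[of "- real (idx v)"]
    unfolding angle_def by linarith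
qed

text \<open>An order of \<open>G\<close> with \<open>uv\<close> added is an instance of the relation
  and order in \<open>rigid\<close>, by which \<open>uv\<close> would already be an edge of
  \<open>G\<close>.\<close>

lemma maximal: "maximal_pseudo_outerplanar G"
  unfolding maximal_pseudo_outerplanar_def
proof (intro conjI ballI impI)
  show "pseudo_outerplanar G" using one_crossing_order_angle simple by (auto simp: pseudo_outerplanar_iff_order)
  fix u v assume uv: "u \<in> verts G" "v \<in> verts G" "u \<noteq> v \<and> {u, v} \<notin> edges G"
  then obtain i j where ij: "u = w i" "v = w j" "i < n" "j < n" unfolding verts_eq by auto
  show "\<not> pseudo_outerplanar (add_edge G {u, v})"
  proof
    assume "pseudo_outerplanar (add_edge G {u, v})"
    then obtain \<sigma> :: "'a \<Rightarrow> real" where \<sigma>: "one_crossing_order \<sigma> (add_edge G {u, v})"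
      by (auto simp: pseudo_outerplanar_iff_order)
    let ?F = "\<lambda>k l. k < n \<and> l < n \<and> {w k, w l} \<in> insert {u, v} (edges G)"
    have "E i j"
    proof (rule rigid[of ?F "\<lambda>k. \<sigma> (w k)"])
      show "?F k l" if "E k l" for k l using that by (simp add: E_iff)
      show "?F l k" if "?F k l" for k l using that by (simp add: insert_commute)
      show "k < n" if "?F k l" for k l using that by simp
      show "\<not> ?F k k" for k
        using uv(3) simple by (auto simp: simple_graph_def doubleton_eq_iff)
      show "{k, l} = {k', l'}" if F: "?F a b" "?F k l" "?F k' l'"
        and c: "interleave (\<sigma> (w a)) (\<sigma> (w b)) (\<sigma> (w k)) (\<sigma> (w l))"
          "interleave (\<sigma> (w a)) (\<sigma> (w b)) (\<sigma> (w k')) (\<sigma> (w l'))" for a b k l k' l'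
      proof -
        have "{w k, w l} = {w k', w l'}"
        proof -
          have "crosses \<sigma> {w a, w b} {w k, w l}" "crosses \<sigma> {w a, w b} {w k', w l'}" using c by simp_all
          moreover have "{w a, w b} \<in> edges (add_edge G {u, v})" "{w k, w l} \<in> edges (add_edge G {u, v})"
            "{w k', w l'} \<in> edges (add_edge G {u, v})" using F by (simp_all add: add_edge_def)
          ultimately show ?thesis using \<sigma> unfolding one_crossing_order_def by blast
        qed
        then show ?thesis using F by (simp add: doubleton_eq_iff w_eq)
      qed
      have "inj_on \<sigma> (w ` {..<n})" using \<sigma> by (simp add: one_crossing_order_def add_edge_def verts_eq)
      then show "inj_on (\<lambda>k. \<sigma> (w k)) {..<n}"
        using bij by (auto simp: inj_on_def bij_betw_def)
      show "?F i j" using ij by simp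
    qed
    then show False using uv ij by (simp add: E_iff)
  qed
qed

lemma reachable_down:
  assumes "\<And>k. i \<le> k \<Longrightarrow> k < j \<Longrightarrow> {w k, w (Suc k)} \<in> edges H" "i \<le> j"
  shows "reachable H (w j) (w i)"
  using assms(2,1)
proof (induction j rule: dec_induct)
  case base
  show ?case by (simp add: reachable_def)
next
  case (step j)
  then have 1: "reachable H (w j) (w i)" by simp
  have 2: "reachable H (w (Suc j)) (w j)"
    using step by (intro reachable_sym[OF reachable_edge]) simp
  show ?case by (rule reachable_trans[OF 2 1])
qed

lemma path_edge_w: "Suc k < n \<Longrightarrow> {w k, w (Suc k)} \<in> edges G"
  using path_edge[of k] by (simp add: E_iff)

text \<open>The boundary cycle is Hamiltonian, and without one vertex it is still a path through all
  the others.\<close>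

lemma two_connected:
  assumes "n \<ge> 3"
  shows "two_connected G"
  unfolding two_connected_def
proof (intro conjI ballI)
  have "card (verts G) = n" using bij_betw_same_card[OF bij] by simp
  then show "3 \<le> card (verts G)" using assms by simp
  show "connected_graph G"
  proof (rule connected_graphI)
    show "w 0 \<in> verts G" using two by (auto simp: verts_eq)
    fix v assume "v \<in> verts G"
    then obtain i where "v = w i" "i < n" by (auto simp: verts_eq)
    then show "reachable G v (w 0)" by (auto intro!: reachable_down path_edge_w)
  qed
  fix z assume "z \<in> verts G"
  then obtain k where k: "z = w k" "k < n" by (auto simp: verts_eq)
  let ?H = "delete_vertex G z"
  have Hv: "w i \<in> verts ?H" if "i < n" "i \<noteq> k" for i
    using that k by (auto simp: delete_vertex_def verts_eq w_eq)
  have He: "{w i, w j} \<in> edges ?H" if "E i j" "i \<noteq> k" "j \<noteq> k" for i j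
    using that k by (auto simp: delete_vertex_def E_iff w_eq)
  have low: "reachable ?H (w i) (w 0)" if "i < k" for i
    by (rule reachable_down) (use that k(2) path_edge in \<open>auto intro!: He\<close>)
  have high: "reachable ?H (w i) (w (n - 1))" if "i < n" "k < i" for i
    by (rule reachable_sym, rule reachable_down) (use that path_edge in \<open>auto intro!: He\<close>)
  have wrap: "reachable ?H (w 0) (w (n - 1))" if "k \<noteq> 0" "k \<noteq> n - 1"
    using that ends_edge two by (intro reachable_edge He) auto
  show "connected_graph ?H"
  proof (rule connected_graphI)
    \<comment> \<open>All vertices are led to the last position, or to the first one if the last is
      the deleted one.\<close>
    let ?b = "if k = n - 1 then 0 else n - 1"
    show "w ?b \<in> verts ?H" using assms k by (intro Hv) auto
    fix v assume "v \<in> verts ?H"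
    then obtain i where i: "v = w i" "i < n" "i \<noteq> k" using k by (auto simp: delete_vertex_def verts_eq)
    show "reachable ?H v (w ?b)"
    proof (cases "i < k")
      case True
      show ?thesis
      proof (cases "k = n - 1")
        case last: False
        then have "reachable ?H (w i) (w (n - 1))" using True wrap by (intro reachable_trans[OF low[OF True]]) simp
        then show ?thesis using i last by simp
      qed (use low[OF True] i in simp)
    next
      case False
      then show ?thesis using high[of i] i by auto
    qed
  qed
qed

lemma block_self: "block G G"
proof (cases "n \<ge> 3")
  case True
  then have "two_connected G" by (rule two_connected)
  then show ?thesis using simple by (auto simp: block_def subgraph_def prod_eq_iff)
next
  case False
  then have n: "n = 2" using two by simp
  let ?e = "{w 0, w 1}"
  have e: "?e \<in> edges G" using path_edge_w[of 0] n by simp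
  have "edges G = {?e}"
  proof
    show "edges G \<subseteq> {?e}"
    proof
      fix e assume "e \<in> edges G"
      then obtain i j where "e = {w i, w j}" "i < n" "j < n" "E i j" by (rule edge_idxE)
      then show "e \<in> {?e}" using n irrefl by (cases i; cases j) (auto simp: less_Suc_eq numeral_2_eq_2)
    qed
  qed (use e in simp)
  moreover have "verts G = ?e" unfolding verts_eq n by (auto simp: numeral_2_eq_2 lessThan_Suc)
  moreover have "\<not> reachable (delete_edge G ?e) (w 0) (w 1)"
    using \<open>edges G = {?e}\<close> w_eq[of 0 1] n by (simp add: reachable_def delete_edge_def)
  ultimately have "bridge G ?e" "G = (?e, {?e})" using e by (auto simp: bridge_def prod_eq_iff)
  then show ?thesis unfolding block_def by blast
qed

lemma boundary:
  assumes "Suc i < n"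
  shows "boundary_edge G (\<lambda>_. chord_drawing angle) {w i, w (Suc i)}"
  unfolding boundary_edge_def
proof (intro exI conjI)
  show "block G G" by (rule block_self)
  let ?vs = "map w [0..<n]"
  show "clockwise_order G (chord_drawing angle) ?vs"
    unfolding clockwise_order_def
  proof (intro conjI exI allI impI)
    show "distinct ?vs" using bij by (simp add: distinct_map bij_betw_def atLeast0LessThan)
    show "set ?vs = verts G" by (auto simp: verts_eq)
    show "point_of (chord_drawing angle) (?vs ! i) = cis (arctan (- real i))" if "i < length ?vs" for i
      using that by (simp add: chord_drawing_def angle_def)
    show "arctan (- real j) < arctan (- real i)" if "i < j \<and> j < length ?vs" for i j
      using that by (simp add: arctan_less_iff)
    show "arctan (- real 0) - arctan (- real i) < 2 * pi" for i
      using arctan_bounded[of "- real i"] by simp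
  qed
  show "i < length ?vs" "{w i, w (Suc i)} = {?vs ! i, ?vs ! ((i + 1) mod length ?vs)}"
    using assms by simp_all
  show "{w i, w (Suc i)} \<in> edges G" using assms by (rule path_edge_w)
qed

text \<open>A crossing of two chords comes from a K_4, which also has a crossing in
  \<open>d\<close>. That crossing determines the two edges through it, as no third edge passes
  there, hence the four vertices and the original crossing.\<close>

lemma crossing_number_le:
  assumes d: "pseudo_outerplanar_drawing G d"
  shows "crossing_number_of G (chord_drawing angle) \<le> crossing_number_of G d"
  unfolding crossing_number_of_def
proof (rule card_le_if_inj_on_rel)
  let ?c = "chord_drawing angle" and ?\<sigma> = "\<lambda>v. Arg (point_of d v)"
  have dd: "disk_drawing G d" using d by (simp add: pseudo_outerplanar_drawing_def)
  have \<sigma>: "one_crossing_order ?\<sigma> G" using pseudo_outerplanar_drawing_one_crossing_order[OF simple d] .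
  \<comment> \<open>The edges crossing in \<open>d\<close> need not be the diagonals
    \<open>ac\<close> and \<open>bd\<close>; only the set of their four ends is kept.\<close>
  define R where "R z z' \<longleftrightarrow> (\<exists>a b c d' e f. E a c \<and> E b d' \<and> a < b \<and> b < c \<and> c < d' \<and>
      z \<in> crossing_points G ?c {w a, w c} {w b, w d'} \<and> e \<in> edges G \<and> f \<in> edges G \<and> e \<noteq> f \<and>
      e \<union> f = {w a, w b, w c, w d'} \<and> z' \<in> crossing_points G d e f)" for z z'
  have "finite (crossing_points G d e f)" if "e \<in> edges G" "f \<in> edges G - {e}" for e f
  proof -
    have "finite (path_image (curve_of d e) \<inter> path_image (curve_of d f))"
      using dd that unfolding disk_drawing_def by blast
    then show ?thesis by (simp add: crossing_points_def)
  qed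
  then show "finite (\<Union>e\<in>edges G. \<Union>f\<in>edges G - {e}. crossing_points G d e f)"
    using finite_edges[OF simple] by auto
  show "\<exists>z'. z' \<in> (\<Union>e\<in>edges G. \<Union>f\<in>edges G - {e}. crossing_points G d e f) \<and> R z z'"
    if z: "z \<in> (\<Union>e\<in>edges G. \<Union>f\<in>edges G - {e}. crossing_points G ?c e f)" for z
  proof -
    from z obtain e f where ef: "e \<in> edges G" "f \<in> edges G" "e \<noteq> f" "z \<in> crossing_points G ?c e f" by blast
    then have cr: "crosses angle e f" using crossing_imp_crosses by blast
    obtain i j where i: "e = {w i, w j}" "E i j" "i < n" "j < n" using ef(1) by (rule edge_idxE)
    obtain k l where k: "f = {w k, w l}" "E k l" "k < n" "l < n" using ef(2) by (rule edge_idxE)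
    have "interleave i j k l" using cr i k by (simp add: interleave_angle)
    then obtain a b c d' where q: "E a c" "E b d'" "a < b" "b < c" "c < d'"
      "{i, j} = {a, c} \<and> {k, l} = {b, d'} \<or> {i, j} = {b, d'} \<and> {k, l} = {a, c}"
      using ordered_crossing[OF i(2) k(2)] by metis
    have n: "a < n" "b < n" "c < n" "d' < n" using q bound bound' by blast+
    have "{e, f} = {{w a, w c}, {w b, w d'}}"
      using q(6) unfolding i(1) k(1) by (auto simp: doubleton_eq_iff)
    then have za: "z \<in> crossing_points G ?c {w a, w c} {w b, w d'}"
      using ef(4) by (auto simp: doubleton_eq_iff crossing_points_def)
    have K4: "{w a, w b} \<in> edges G" "{w b, w c} \<in> edges G" "{w c, w d'} \<in> edges G" "{w a, w d'} \<in> edges G"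
      "{w a, w c} \<in> edges G" "{w b, w d'} \<in> edges G"
      using sides[OF q(1-5)] q(1,2) by (auto simp: E_iff)
    have inj\<sigma>: "?\<sigma> (w x) = ?\<sigma> (w y) \<longleftrightarrow> x = y" if "x < n" "y < n" for x y
    proof -
      have "w x \<in> verts G" "w y \<in> verts G" using that by (auto simp: verts_eq)
      then show ?thesis using \<sigma> w_eq[OF that] unfolding one_crossing_order_def inj_on_def by metis
    qed
    have "interleave (?\<sigma> (w a)) (?\<sigma> (w b)) (?\<sigma> (w c)) (?\<sigma> (w d')) \<or>
       interleave (?\<sigma> (w a)) (?\<sigma> (w c)) (?\<sigma> (w b)) (?\<sigma> (w d')) \<or>
       interleave (?\<sigma> (w a)) (?\<sigma> (w d')) (?\<sigma> (w b)) (?\<sigma> (w c))"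
      by (rule interleave_pairing) (use q n in \<open>simp_all add: inj\<sigma>\<close>)
    then have "\<exists>e'\<in>edges G. \<exists>f'\<in>edges G. crosses ?\<sigma> e' f' \<and> e' \<union> f' = {w a, w b, w c, w d'}"
    proof (elim disjE)
      assume "interleave (?\<sigma> (w a)) (?\<sigma> (w b)) (?\<sigma> (w c)) (?\<sigma> (w d'))"
      then show ?thesis using K4 by (intro bexI[of _ "{w a, w b}"] bexI[of _ "{w c, w d'}"]) auto
    next
      assume "interleave (?\<sigma> (w a)) (?\<sigma> (w c)) (?\<sigma> (w b)) (?\<sigma> (w d'))"
      then show ?thesis using K4 by (intro bexI[of _ "{w a, w c}"] bexI[of _ "{w b, w d'}"]) auto
    next
      assume "interleave (?\<sigma> (w a)) (?\<sigma> (w d')) (?\<sigma> (w b)) (?\<sigma> (w c))"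
      then show ?thesis using K4 by (intro bexI[of _ "{w a, w d'}"] bexI[of _ "{w b, w c}"]) auto
    qed
    then obtain e' f' where e': "e' \<in> edges G" "f' \<in> edges G" "crosses ?\<sigma> e' f'"
      "e' \<union> f' = {w a, w b, w c, w d'}" by blast
    then obtain z' where z': "z' \<in> crossing_points G d e' f'"
      using disk_drawing_crosses[OF simple dd] by blast
    have ne: "e' \<noteq> f'" using e'(3) by (rule crosses_ne)
    have "R z z'" unfolding R_def using e' q(1-5) za ne z'
      by (intro exI[of _ a] exI[of _ b] exI[of _ c] exI[of _ d'] exI[of _ e'] exI[of _ f'] conjI)
    moreover have "z' \<in> (\<Union>e\<in>edges G. \<Union>f\<in>edges G - {e}. crossing_points G d e f)"
      using e'(1,2) ne z' by blast
    ultimately show ?thesis by blast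
  qed
  show "z1 = z2" if R: "R z1 z'" "R z2 z'" for z1 z2 z'
  proof -
    obtain a b c d' e f where 1: "E a c" "E b d'" "a < b" "b < c" "c < d'"
      "z1 \<in> crossing_points G ?c {w a, w c} {w b, w d'}" "e \<in> edges G" "f \<in> edges G" "e \<noteq> f"
      "e \<union> f = {w a, w b, w c, w d'}" "z' \<in> crossing_points G d e f"
      using R(1) unfolding R_def by (elim exE conjE) (rule that)
    obtain a2 b2 c2 d2 e2 f2 where 2: "E a2 c2" "E b2 d2" "a2 < b2" "b2 < c2" "c2 < d2"
      "z2 \<in> crossing_points G ?c {w a2, w c2} {w b2, w d2}" "e2 \<in> edges G" "f2 \<in> edges G" "e2 \<noteq> f2"
      "e2 \<union> f2 = {w a2, w b2, w c2, w d2}" "z' \<in> crossing_points G d e2 f2"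
      using R(2) unfolding R_def by (elim exE conjE) (rule that)
    \<comment> \<open>All these edges pass through \<open>z'\<close>, so \<open>g\<close> and
      \<open>f\<close> both cross \<open>e\<close>, which admits only one such edge.\<close>
    have near: "g = f" if "g \<in> {e2, f2}" "g \<noteq> e" for g
    proof (rule pseudo_outerplanar_drawing_at_most_one[OF simple d 1(7)])
      show "g \<in> edges G" using that 2 by blast
      have "z' \<in> crossing_points G d e g" using that 1(11) 2(11) by (auto simp: crossing_points_def)
      then show "crossing_points G d e g \<noteq> {}" by blast
    qed (use 1 that in auto)
    have "{e2, f2} = {e, f}" using near[of e2] near[of f2] 2(9) by auto
    then have "e2 \<union> f2 = e \<union> f" by (auto simp: doubleton_eq_iff)
    then have wset: "w ` {a, b, c, d'} = w ` {a2, b2, c2, d2}" using 1(10) 2(10) by simp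
    have "inj_on w {..<n}" using bij by (simp add: bij_betw_def)
    moreover have "{a, b, c, d'} \<subseteq> {..<n}" "{a2, b2, c2, d2} \<subseteq> {..<n}" using 1 2 bound bound' by auto
    ultimately have "{a, b, c, d'} = {a2, b2, c2, d2}" using wset by (rule inj_on_image_eq_iff[THEN iffD1])
    \<comment> \<open>Both quadruples are increasing, so they agree as lists once they agree as
      sets.\<close>
    then have "[a, b, c, d'] = [a2, b2, c2, d2]"
      using 1 2 by (intro sorted_distinct_set_unique) auto
    then have z2: "z2 \<in> crossing_points G ?c {w a, w c} {w b, w d'}" using 2(6) by simp
    have ed: "{w a, w c} \<in> edges G" "{w b, w d'} \<in> edges G" using 1(1,2) by (simp_all add: E_iff)
    have "w a \<noteq> w b" "w a \<noteq> w d'" using 1 w_eq bound bound' by (metis less_irrefl less_trans)+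
    then have "{w a, w c} \<noteq> {w b, w d'}" by (simp add: doubleton_eq_iff)
    then show ?thesis using chords_meet[OF ed] 1(6) z2 by (auto simp: crossing_points_def)
  qed
qed

text \<open>A 2-connected block can only be \<open>G\<close> itself, to which
  \<open>crossing_number_le\<close> applies; a bridge has one edge and no crossing.\<close>

lemma diagram: "pseudo_outerplanar_diagram G (\<lambda>_. chord_drawing angle)"
  unfolding pseudo_outerplanar_diagram_def
proof (intro conjI allI impI)
  show "block_drawing G (\<lambda>_. chord_drawing angle)"
    unfolding block_drawing_def
  proof (intro allI impI)
    fix B assume "block G B"
    then have B: "subgraph B G" by (rule block_subgraph[OF simple])
    then have "simple_graph B" "verts B \<subseteq> verts G" by (simp_all add: subgraph_def)
    then interpret B: vertex_angles B angle
      using range inj by unfold_locales (auto intro: inj_on_subset)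
    show "pseudo_outerplanar_drawing B (chord_drawing angle)"
      using B.chord_drawing_pseudo_outerplanar one_crossing_order_subgraph[OF one_crossing_order_angle B] .
  qed
  fix D' assume D': "block_drawing G D'"
  have "crossing_number_of B (chord_drawing angle) \<le> crossing_number_of B (D' B)" if B: "block G B" for B
    using B[unfolded block_def]
  proof
    assume *: "subgraph B G \<and> two_connected B \<and> (\<forall>C. subgraph C G \<and> two_connected C \<and> subgraph B C \<longrightarrow> C = B)"
    have "card (verts B) \<le> card (verts G)" using * simple by (auto simp: subgraph_def simple_graph_def intro: card_mono)
    then have "n \<ge> 3" using * bij_betw_same_card[OF bij] by (auto simp: two_connected_def)
    then have "two_connected G" by (rule two_connected)
    moreover have "subgraph G G" using simple by (simp add: subgraph_def)
    ultimately have "B = G" using * by blast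
    moreover have "pseudo_outerplanar_drawing B (D' B)" using D' B unfolding block_drawing_def by blast
    ultimately show ?thesis using crossing_number_le[of "D' B"] by simp
  next
    assume "\<exists>e. bridge G e \<and> B = (e, {e})"
    then show ?thesis by (auto simp: crossing_number_of_def)
  qed
  then show "total_crossings G (\<lambda>_. chord_drawing angle) \<le> total_crossings G D'"
    unfolding total_crossings_def by (intro sum_mono) simp
qed

end

section \<open>Splitting off the triangle or K_4\<close>

theorem theorem3p5:
  fixes G :: "'a graph"
  assumes "maximal_pseudo_outerplanar G"
    and "card (verts G) \<ge> 3"
  shows "\<exists>H D x y K.
           maximal_pseudo_outerplanar H \<and>
           pseudo_outerplanar_diagram H D \<and>
           boundary_edge H D {x, y} \<and>
           (complete_graph 3 K \<or> complete_graph 4 K) \<and>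
           glued_along_edge G H K x y"
proof -
  define n where "n = card (verts G)"
  have n3: "n \<ge> 3" using assms(2) by (simp add: n_def)
  have S: "simple_graph G" using assms(1) by (simp add: maximal_pseudo_outerplanar_def pseudo_outerplanar_def)
  obtain w where w: "bij_betw w {..<n} (verts G)"
    and mo: "maximal_order n (\<lambda>i j. i < n \<and> j < n \<and> {w i, w j} \<in> edges G)"
    using maximal_pseudo_outerplanar_order[OF assms(1)] unfolding n_def by blast
  define E where "E i j \<longleftrightarrow> i < n \<and> j < n \<and> {w i, w j} \<in> edges G" for i j
  interpret maximal_order n E using mo unfolding E_def .
  obtain x y where xy: "E x y" "uncrossed x y" "y < n" "y = x + 2 \<or> y = x + 3 \<and> E x (x + 2) \<and> E (x + 1) (x + 3)"
    using leaf_exists[OF n3] by blast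
  have xly: "x < y" using xy(4) by auto
  define sk where "sk i = (if i \<le> x then i else i + (y - x - 1))" for i
  define m where "m = n - (y - x - 1)"
  have weq: "w i = w j \<longleftrightarrow> i = j" if "i < n" "j < n" for i j
    using w that by (auto simp: bij_betw_def inj_on_def)
  have V: "verts G = w ` {..<n}" using w by (simp add: bij_betw_def)
  define I where "I = {i. i < n \<and> (i \<le> x \<or> y \<le> i)}"
  have sk: "bij_betw sk {..<m} I"
  proof (rule bij_betwI[where g = "\<lambda>i. if i \<le> x then i else i - (y - x - 1)"])
  qed (use xly xy(3) in \<open>auto simp: sk_def I_def m_def\<close>)
  define H where "H = (w ` I, {e \<in> edges G. e \<subseteq> w ` I})"
  \<comment> \<open>\<open>K\<close> is complete by definition; that its edges belong to
    \<open>G\<close> is the content of \<open>eK\<close>.\<close>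
  define K where "K = (w ` {x..y}, {e. e \<subseteq> w ` {x..y} \<and> card e = 2})"
  have IV: "w ` I \<subseteq> verts G" by (auto simp: V I_def)
  have skn: "sk i < n \<longleftrightarrow> i < m" for i using xly xy(3) by (auto simp: sk_def m_def)
  have skI: "w (sk i) \<in> w ` I" if "i < m" for i using sk that by (auto simp: bij_betw_def)
  interpret H: saturated_graph m "\<lambda>i j. E (sk i) (sk j)" H "\<lambda>i. w (sk i)"
  proof (rule saturated_graph.intro)
    show "saturated_order m (\<lambda>i j. E (sk i) (sk j))"
      using leaf_removed[OF xy(1,2) xly] by (simp add: sk_def[abs_def] m_def)
    show "saturated_graph_axioms m (\<lambda>i j. E (sk i) (sk j)) H (\<lambda>i. w (sk i))"
    proof
      have "finite (verts G)" using S by (simp add: simple_graph_def)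
      then show "simple_graph H" using S IV unfolding simple_graph_def H_def by (auto intro: finite_subset)
      have "inj_on w I" using w by (auto simp: bij_betw_def I_def inj_on_def)
      then have "bij_betw w I (verts H)" by (simp add: bij_betw_def H_def)
      with sk have "bij_betw (w \<circ> sk) {..<m} (verts H)" by (rule bij_betw_trans)
      then show "bij_betw (\<lambda>i. w (sk i)) {..<m} (verts H)" by (simp add: comp_def)
      show "2 \<le> m" using xly xy(3) by (simp add: m_def)
      show "E (sk i) (sk j) \<longleftrightarrow> i < m \<and> j < m \<and> {w (sk i), w (sk j)} \<in> edges H" for i j
        using skI skn by (auto simp: E_def H_def)
    qed
  qed
  \<comment> \<open>\<open>x\<close> and \<open>y\<close> occupy the consecutive positions
    \<open>x\<close> and \<open>Suc x\<close> of \<open>H\<close>, which is why \<open>xy\<close> is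
    a boundary edge.\<close>
  have Sx: "Suc x < m" using xly xy(3) by (simp add: m_def)
  have skx: "sk x = x" "sk (Suc x) = y" using xly by (auto simp: sk_def)
  have "x < n" using xly xy(3) by simp
  have bd: "boundary_edge H (\<lambda>_. chord_drawing H.angle) {w x, w y}"
    using H.boundary[OF Sx] by (simp add: skx)
  have cardK: "card (w ` {x..y}) = y - x + 1"
  proof -
    have "inj_on w {x..y}" using w xy(3) by (auto simp: bij_betw_def inj_on_def)
    then show ?thesis using xly by (simp add: card_image)
  qed
  then have cK: "complete_graph 3 K \<or> complete_graph 4 K"
    using xy(4) by (auto simp: complete_graph_def K_def)
  \<comment> \<open>The sides are consecutive pairs and \<open>xy\<close>; for four vertices,
    \<open>leaf_exists\<close> supplies the diagonals.\<close>
  have clique: "E i j" if "x \<le> i" "i < j" "j \<le> y" for i j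
  proof -
    have p: "E x (x + 1)" "E (x + 1) (x + 2)" "y = x + 3 \<Longrightarrow> E (x + 2) (x + 3)"
      using path_edge[of x] path_edge[of "x + 1"] path_edge[of "x + 2"] xly xy(3,4) by (auto simp: numeral_eq_Suc)
    have "i = x \<or> i = x + 1 \<or> i = x + 2" "j = x + 1 \<or> j = x + 2 \<or> j = x + 3" using that xy(4) by linarith+
    then show ?thesis using p xy(1,4) that by auto
  qed
  have eK: "edges K \<subseteq> edges G"
  proof
    fix e assume "e \<in> edges K"
    then have "card e = 2" "e \<subseteq> w ` {x..y}" by (auto simp: K_def)
    then obtain a b where ab: "e = {a, b}" "a \<noteq> b" "a \<in> w ` {x..y}" "b \<in> w ` {x..y}"
      by (auto simp: card_2_iff)
    then obtain i j where "a = w i" "b = w j" "i \<in> {x..y}" "j \<in> {x..y}" by blast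
    with ab have e: "e = {w i, w j}" "i \<noteq> j" "x \<le> i" "i \<le> y" "x \<le> j" "j \<le> y"
      by auto
    then have "E i j" using clique[of i j] clique[of j i] sym by (cases i j rule: linorder_cases) auto
    then show "e \<in> edges G" using e by (simp add: E_def)
  qed
  have eHK: "edges G \<subseteq> edges H \<union> edges K"
  proof
    fix e assume e: "e \<in> edges G"
    then have c: "card e = 2" "e \<subseteq> verts G" using S by (auto simp: simple_graph_def)
    then obtain a b where ab: "e = {a, b}" "a \<noteq> b" "a \<in> w ` {..<n}" "b \<in> w ` {..<n}"
      unfolding V by (auto simp: card_2_iff)
    then obtain i j where "a = w i" "b = w j" "i \<in> {..<n}" "j \<in> {..<n}" by blast
    with ab have ij: "e = {w i, w j}" "i < n" "j < n" "i \<noteq> j" by auto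
    then have Eij: "E i j" using e by (simp add: E_def)
    show "e \<in> edges H \<union> edges K"
    proof (cases "i \<in> I \<and> j \<in> I")
      case True then show ?thesis using e ij by (auto simp: H_def)
    next
      case False
      then have "x < i \<and> i < y \<or> x < j \<and> j < y" using ij by (auto simp: I_def)
      \<comment> \<open>An edge with an end strictly between \<open>x\<close> and \<open>y\<close>
        cannot leave the interval without crossing \<open>xy\<close>.\<close>
      then have "x \<le> i \<and> i \<le> y \<and> x \<le> j \<and> j \<le> y"
        using uncrossedD[OF xy(2) Eij] xly unfolding interleave_xor by linarith
      then show ?thesis using ij c by (auto simp: K_def)
    qed
  qed
  have "glued_along_edge G H K (w x) (w y)"
    unfolding glued_along_edge_def
  proof (intro conjI)
    show "w x \<noteq> w y" using weq \<open>x < n\<close> xy(3) xly by simp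
    have "x \<in> I" "y \<in> I" using \<open>x < n\<close> xy(3) by (auto simp: I_def)
    then show "{w x, w y} \<in> edges H" using xy(1) by (auto simp: H_def E_def)
    show "{w x, w y} \<in> edges K" using \<open>w x \<noteq> w y\<close> xly by (simp add: K_def)
    have "w ` I \<inter> w ` {x..y} = w ` (I \<inter> {x..y})"
      using w xy(3) by (intro inj_on_image_Int[symmetric, of w "{..<n}"]) (auto simp: bij_betw_def I_def)
    also have "I \<inter> {x..y} = {x, y}" using xly xy(3) by (auto simp: I_def)
    finally show "verts H \<inter> verts K = {w x, w y}" by (simp add: H_def K_def)
    have "{..<n} = I \<union> {x..y}" using xy(3) xly by (auto simp: I_def)
    then have "verts G = verts H \<union> verts K" unfolding V by (simp add: H_def K_def image_Un)
    moreover have "edges G = edges H \<union> edges K" using eHK eK by (auto simp: H_def)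
    ultimately show "G = graph_union H K" by (simp add: graph_union_def prod_eq_iff)
  qed
  then show ?thesis using H.maximal H.diagram bd cK by blast
qed

end
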